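(* Let $g \in \mathcal{S}_d^n$ be computed by a skew arithmetic circuit $C$, and let $X = (\ell_{i,j})_{i,j \in [d]}$ be a $d\times d$ symbolic Hankel matrix whose entries are homogeneous linear forms in $\mathcal{S}_1^n$. Then, given $C$ and $X$, the quantity $\langle \det X, g \rangle$ can be computed with $\varphi^{2d}\,\mathrm{poly}(d)\,|C|$ arithmetic operations, where $\varphi = \frac{1+\sqrt{5}}{2}$ is the golden ratio.
   Context: $\mathcal{S}_d^n = \mathbb{R}[x_1,\ldots,x_n]_d$ denotes the vector space of homogeneous polynomials of degree $d$ in $n$ variables with real coefficients. The apolar inner product on $\mathcal{S}_d^n$ is $\langle f, g\rangle := f(\partial/\partial x_1, \ldots, \partial/\partial x_n)\, g$. A matrix $X$ is Hankel if $X_{i,j} = X_{i+k,j-k}$ for all admissible $k$, i.e. $X_{i,j}$ depends only on $i+j$. An arithmetic circuit is skew if at each multiplication gate one of the two operands is an input variable or a scalar. $|C|$ denotes the total number of gates of $C$. *)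

theory Defs
  imports Complex_Main "HOL-Library.Poly_Mapping" "Jordan_Normal_Form.Determinant"
begin

section \<open>Forms and the apolar inner product\<close>

text \<open>Polynomials over the reals in the variables \<open>x\<^sub>0, x\<^sub>1, \<dots>\<close>: a monomial is its finitely
  supported exponent vector, a polynomial is the finitely supported map of its coefficients.
  Multiplication is the convolution product of \<^theory>\<open>HOL-Library.Poly_Mapping\<close>.\<close>

type_synonym monomial = "nat \<Rightarrow>\<^sub>0 nat"
type_synonym rpoly = "monomial \<Rightarrow>\<^sub>0 real"

definition const :: "real \<Rightarrow> rpoly" where
  "const c = Poly_Mapping.single 0 c"

definition var_monomial :: "nat \<Rightarrow> monomial" where
  "var_monomial v = Poly_Mapping.single v 1"

definition var :: "nat \<Rightarrow> rpoly" where
  "var v = Poly_Mapping.single (var_monomial v) 1"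

definition mdegree :: "monomial \<Rightarrow> nat" where
  "mdegree m = (\<Sum>v\<in>Poly_Mapping.keys m. Poly_Mapping.lookup m v)"

definition forms :: "nat \<Rightarrow> nat \<Rightarrow> rpoly set" where
  "forms n d = {f. \<forall>m\<in>Poly_Mapping.keys f. Poly_Mapping.keys m \<subseteq> {..<n} \<and> mdegree m = d}"

definition partial :: "nat \<Rightarrow> rpoly \<Rightarrow> rpoly" where
  "partial v g = (\<Sum>m\<in>Poly_Mapping.keys g.
     Poly_Mapping.single (m - var_monomial v)
       (of_nat (Poly_Mapping.lookup m v) * Poly_Mapping.lookup g m))"

text \<open>The partial derivatives commute, so the order of the variables is immaterial.\<close>

definition partial_monomial :: "monomial \<Rightarrow> rpoly \<Rightarrow> rpoly" where
  "partial_monomial m =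
     fold (\<lambda>v. partial v ^^ Poly_Mapping.lookup m v) (sorted_list_of_set (Poly_Mapping.keys m))"

text \<open>The polynomial \<open>f(\<partial>/\<partial>x\<^sub>0, \<partial>/\<partial>x\<^sub>1, \<dots>) g\<close>; it is a constant if \<open>f\<close> and \<open>g\<close> are forms of the
  same degree.\<close>

definition apolar :: "rpoly \<Rightarrow> rpoly \<Rightarrow> rpoly" where
  "apolar f g = (\<Sum>m\<in>Poly_Mapping.keys f. const (Poly_Mapping.lookup f m) * partial_monomial m g)"

definition hankel :: "'a mat \<Rightarrow> bool" where
  "hankel X \<longleftrightarrow> (\<forall>i j i' j'.
     i < dim_row X \<and> j < dim_col X \<and> i' < dim_row X \<and> j' < dim_col X \<and> i + j = i' + j'
     \<longrightarrow> X $$ (i, j) = X $$ (i', j'))"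

definition golden_ratio :: real where
  "golden_ratio = (1 + sqrt 5) / 2"


section \<open>Skew arithmetic circuits\<close>

text \<open>The gates of a circuit are listed in a topological order, and the operands of a gate are
  positions in that list. Input gates (variables and scalars) are gates.\<close>

datatype gate = Var nat | Scalar real | Plus nat nat | Times nat nat

datatype circuit = Circuit (gates: "gate list") (out_gate: nat)

definition num_gates :: "circuit \<Rightarrow> nat" where
  "num_gates C = length (gates C)"

fun wf_gate :: "nat \<Rightarrow> nat \<Rightarrow> gate \<Rightarrow> bool" where
  "wf_gate n k (Var v) \<longleftrightarrow> v < n"
| "wf_gate n k (Scalar c) \<longleftrightarrow> True"
| "wf_gate n k (Plus i j) \<longleftrightarrow> i < k \<and> j < k"
| "wf_gate n k (Times i j) \<longleftrightarrow> i < k \<and> j < k"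

definition wf_circuit :: "nat \<Rightarrow> circuit \<Rightarrow> bool" where
  "wf_circuit n C \<longleftrightarrow>
     out_gate C < num_gates C \<and> (\<forall>k<num_gates C. wf_gate n k (gates C ! k))"

fun is_input :: "gate \<Rightarrow> bool" where
  "is_input (Var v) \<longleftrightarrow> True"
| "is_input (Scalar c) \<longleftrightarrow> True"
| "is_input (Plus i j) \<longleftrightarrow> False"
| "is_input (Times i j) \<longleftrightarrow> False"

definition skew :: "circuit \<Rightarrow> bool" where
  "skew C \<longleftrightarrow> (\<forall>k<num_gates C. \<forall>i j. gates C ! k = Times i j \<longrightarrow>
     is_input (gates C ! i) \<or> is_input (gates C ! j))"

fun gate_poly :: "rpoly list \<Rightarrow> gate \<Rightarrow> rpoly" where
  "gate_poly ps (Var v) = var v"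
| "gate_poly ps (Scalar c) = const c"
| "gate_poly ps (Plus i j) = ps ! i + ps ! j"
| "gate_poly ps (Times i j) = ps ! i * ps ! j"

definition gate_polys :: "gate list \<Rightarrow> rpoly list" where
  "gate_polys gs = foldl (\<lambda>ps g. ps @ [gate_poly ps g]) [] gs"

definition computes :: "circuit \<Rightarrow> rpoly \<Rightarrow> bool" where
  "computes C g \<longleftrightarrow> gate_polys (gates C) ! out_gate C = g"


section \<open>Algorithms and their number of arithmetic operations\<close>

text \<open>Algorithms are programs of an algebraic random access machine: a while language whose store
  consists of named multi-dimensional arrays of natural numbers (control and addressing) and of real
  numbers (data); a scalar variable is an array accessed with the empty index list. Real data can only
  be copied and combined by ring operations, and the control flow cannot depend on it. The cost
  of a run is the number of ring operations performed on real numbers. A program is a finite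
  syntactic object, so one program is one uniform algorithm for inputs of all sizes.\<close>

record store =
  nats :: "string \<Rightarrow> nat list \<Rightarrow> nat"
  reals :: "string \<Rightarrow> nat list \<Rightarrow> real"

datatype nexp =
    NConst nat
  | NGet string "nexp list"
  | NAdd nexp nexp
  | NSub nexp nexp
  | NMul nexp nexp
  | NDiv nexp nexp
  | NMod nexp nexp

fun nval :: "nexp \<Rightarrow> store \<Rightarrow> nat" where
  "nval (NConst k) s = k"
| "nval (NGet a es) s = nats s a (map (\<lambda>e. nval e s) es)"
| "nval (NAdd e f) s = nval e s + nval f s"
| "nval (NSub e f) s = nval e s - nval f s"
| "nval (NMul e f) s = nval e s * nval f s"
| "nval (NDiv e f) s = nval e s div nval f s"
| "nval (NMod e f) s = nval e s mod nval f s"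

datatype bexp =
    Less nexp nexp
  | Equal nexp nexp
  | Neg bexp
  | Conj bexp bexp

fun bval :: "bexp \<Rightarrow> store \<Rightarrow> bool" where
  "bval (Less e f) s \<longleftrightarrow> nval e s < nval f s"
| "bval (Equal e f) s \<longleftrightarrow> nval e s = nval f s"
| "bval (Neg b) s \<longleftrightarrow> \<not> bval b s"
| "bval (Conj b c) s \<longleftrightarrow> bval b s \<and> bval c s"

datatype rexp =
    RConst int
  | RGet string "nexp list"
  | RAdd rexp rexp
  | RSub rexp rexp
  | RMul rexp rexp

fun rval :: "rexp \<Rightarrow> store \<Rightarrow> real" where
  "rval (RConst k) s = of_int k"
| "rval (RGet a es) s = reals s a (map (\<lambda>e. nval e s) es)"
| "rval (RAdd e f) s = rval e s + rval f s"
| "rval (RSub e f) s = rval e s - rval f s"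
| "rval (RMul e f) s = rval e s * rval f s"

fun num_ops :: "rexp \<Rightarrow> nat" where
  "num_ops (RConst k) = 0"
| "num_ops (RGet a es) = 0"
| "num_ops (RAdd e f) = num_ops e + num_ops f + 1"
| "num_ops (RSub e f) = num_ops e + num_ops f + 1"
| "num_ops (RMul e f) = num_ops e + num_ops f + 1"

datatype com =
    Skip
  | NAssign string "nexp list" nexp
  | RAssign string "nexp list" rexp
  | Seq com com
  | If bexp com com
  | While bexp com

definition set_nat :: "string \<Rightarrow> nat list \<Rightarrow> nat \<Rightarrow> store \<Rightarrow> store" where
  "set_nat a ks k s = s\<lparr>nats := (nats s)(a := (nats s a)(ks := k))\<rparr>"

definition set_real :: "string \<Rightarrow> nat list \<Rightarrow> real \<Rightarrow> store \<Rightarrow> store" where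
  "set_real a ks x s = s\<lparr>reals := (reals s)(a := (reals s a)(ks := x))\<rparr>"

text \<open>\<open>run c s N t\<close>: started in the store \<open>s\<close>, the program \<open>c\<close> terminates in the store \<open>t\<close>
  after exactly \<open>N\<close> arithmetic operations.\<close>

inductive run :: "com \<Rightarrow> store \<Rightarrow> nat \<Rightarrow> store \<Rightarrow> bool" where
  run_Skip: "run Skip s 0 s"
| run_NAssign:
    "run (NAssign a es e) s 0 (set_nat a (map (\<lambda>e. nval e s) es) (nval e s) s)"
| run_RAssign:
    "run (RAssign a es e) s (num_ops e) (set_real a (map (\<lambda>e. nval e s) es) (rval e s) s)"
| run_Seq: "run c1 s N1 t \<Longrightarrow> run c2 t N2 u \<Longrightarrow> run (Seq c1 c2) s (N1 + N2) u"
| run_IfTrue: "bval b s \<Longrightarrow> run c1 s N t \<Longrightarrow> run (If b c1 c2) s N t"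
| run_IfFalse: "\<not> bval b s \<Longrightarrow> run c2 s N t \<Longrightarrow> run (If b c1 c2) s N t"
| run_WhileFalse: "\<not> bval b s \<Longrightarrow> run (While b c) s 0 s"
| run_WhileTrue:
    "bval b s \<Longrightarrow> run c s N1 t \<Longrightarrow> run (While b c) t N2 u \<Longrightarrow> run (While b c) s (N1 + N2) u"

lemma run_deterministic:
  "run c s N t \<Longrightarrow> run c s N' t' \<Longrightarrow> N' = N \<and> t' = t"
proof (induction arbitrary: N' t' rule: run.induct)
  case (run_Seq c1 s N1 t c2 N2 u)
  from run_Seq.prems show ?case by (cases rule: run.cases) (use run_Seq.IH in blast)+
next
  case (run_WhileTrue b s c N1 t N2 u)
  from run_WhileTrue.prems show ?case
    by (cases rule: run.cases) (use run_WhileTrue in blast)+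
qed (erule run.cases; blast)+


subsection \<open>The input format\<close>

text \<open>Gates are given by an operation code and up to two natural number arguments; the real numbers
  occurring in the circuit are stored separately. The linear forms are given by their
  coefficients.\<close>

fun gate_code :: "gate \<Rightarrow> nat" where
  "gate_code (Var v) = 0"
| "gate_code (Scalar c) = 1"
| "gate_code (Plus i j) = 2"
| "gate_code (Times i j) = 3"

fun gate_arg1 :: "gate \<Rightarrow> nat" where
  "gate_arg1 (Var v) = v"
| "gate_arg1 (Scalar c) = 0"
| "gate_arg1 (Plus i j) = i"
| "gate_arg1 (Times i j) = i"

fun gate_arg2 :: "gate \<Rightarrow> nat" where
  "gate_arg2 (Var v) = 0"
| "gate_arg2 (Scalar c) = 0"
| "gate_arg2 (Plus i j) = j"
| "gate_arg2 (Times i j) = j"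

fun gate_scalar :: "gate \<Rightarrow> real" where
  "gate_scalar (Var v) = 0"
| "gate_scalar (Scalar c) = c"
| "gate_scalar (Plus i j) = 0"
| "gate_scalar (Times i j) = 0"

definition gate_array :: "(gate \<Rightarrow> 'a) \<Rightarrow> circuit \<Rightarrow> nat list \<Rightarrow> 'a::zero" where
  "gate_array h C ks =
     (case ks of [k] \<Rightarrow> if k < num_gates C then h (gates C ! k) else 0 | _ \<Rightarrow> 0)"

definition coeff_array :: "nat \<Rightarrow> rpoly mat \<Rightarrow> nat list \<Rightarrow> real" where
  "coeff_array n X ks =
     (case ks of
        [i, j, v] \<Rightarrow>
          if i < dim_row X \<and> j < dim_col X \<and> v < n
          then Poly_Mapping.lookup (X $$ (i, j)) (var_monomial v) else 0
      | _ \<Rightarrow> 0)"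

definition scalar_array :: "'a \<Rightarrow> nat list \<Rightarrow> 'a::zero" where
  "scalar_array x ks = (if ks = [] then x else 0)"

definition input_store :: "nat \<Rightarrow> nat \<Rightarrow> circuit \<Rightarrow> rpoly mat \<Rightarrow> store" where
  "input_store n d C X =
     \<lparr>nats = (\<lambda>a ks. 0)
        (''n'' := scalar_array n,
         ''d'' := scalar_array d,
         ''gates'' := scalar_array (num_gates C),
         ''output'' := scalar_array (out_gate C),
         ''code'' := gate_array gate_code C,
         ''arg1'' := gate_array gate_arg1 C,
         ''arg2'' := gate_array gate_arg2 C),
      reals = (\<lambda>a ks. 0)
        (''scalar'' := gate_array gate_scalar C,
         ''X'' := coeff_array n X)\<rparr>"

definition result :: "store \<Rightarrow> real" where
  "result s = reals s ''result'' []"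

end

theory Submission
  imports Defs
begin

text \<open>The apolar pairing satisfies \<open>\<langle>f, x\<^sub>v h\<rangle> = \<langle>\<partial>\<^sub>v f, h\<rangle>\<close>, so along a skew circuit it suffices to tabulate,
  for every gate \<open>h\<close>, the numbers \<open>\<langle>f, h\<rangle>\<close> for \<open>f\<close> in a family whose span contains \<open>det X\<close> and is closed
  under differentiation. Such a family are the maximal minors of the Hankel matrices with \<open>k\<close> rows and
  \<open>2 d - k\<close> columns that have the same antidiagonals as \<open>X\<close>: a derivative of such a minor is a
  combination of minors in which one row and one column are deleted, and deleting a row of a Hankel
  minor amounts to summing over all ways to shift a fixed number of its columns by one. Processing the
  columns one after the other evaluates these sums for all minors simultaneously with \<open>poly(d)\<close>
  operations per minor, and there are \<open>\<Sum>\<^sub>k (2 d - k choose k)\<close> minors, a Fibonacci number that is at most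
  \<open>\<phi>\<^bsup>2 d\<^esup>\<close>. Since natural number computations are free, a minor is encoded by the bit mask of its
  columns and the program simply runs through all masks below \<open>4\<^sup>d\<close>.\<close>

section \<open>The pairing and partial derivatives\<close>

text \<open>Gates of the circuit need not be homogeneous, so what is tabulated is not
  \<open>apolar\<close>, a polynomial in general, but the real number \<open>pairing h f\<close>;
  the two are identified only for forms of equal degree, at the output gate.

  The shape "k rows, 2 d - k columns" is what closes the family. All these matrices live on the same
  2 d - 1 antidiagonals, and giving up one row makes one further column available, exactly the room
  that a shift by one can need.

  The shift rule comes from a generating function in z. Replace every row p -> f p of a determinant
  by p -> f p + z * f (p + 1). Expanding row by row, z counts the shifted rows. A bordered
  determinant shows that the coefficients of the powers of z are also the minors in which one
  position is skipped. No signs appear, so the table is built by additions alone. Collisions of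
  columns need no bookkeeping, since they give equal rows and hence zero.

  The golden ratio enters through the lowest bit of a mask: dropping an unset bit shortens the width
  2 d by one (a column), dropping a set bit by two (a column and a row).\<close>

abbreviation lk :: "('a \<Rightarrow>\<^sub>0 'b::zero) \<Rightarrow> 'a \<Rightarrow> 'b" where "lk \<equiv> Poly_Mapping.lookup"

text \<open>Reduces bilinear identities, such as the Leibniz rule and the adjunction, to single
  monomials.\<close>

lemma rpoly_induct [case_names zero add]:
  fixes f :: rpoly
  assumes "P 0" and "\<And>f m c. P f \<Longrightarrow> P (f + Poly_Mapping.single m c)"
  shows "P f"
proof -
  have "P (\<Sum>m\<in>S. Poly_Mapping.single m (lk f m))" if "finite S" for S
    using that by (induction S rule: finite_induct) (use assms in \<open>auto simp: add.commute[of "Poly_Mapping.single _ _"]\<close>)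
  moreover have "(\<Sum>m\<in>Poly_Mapping.keys f. Poly_Mapping.single m (lk f m)) = f"
    by (rule poly_mapping_eqI)
       (auto simp: lookup_sum lookup_single when_def in_keys_iff)
  ultimately show ?thesis by (metis finite_keys)
qed

lemma monomial_diff_add:
  assumes "0 < lk m v"
  shows "(m - var_monomial v) + var_monomial v = m"
  using assms by (intro poly_mapping_eqI)
    (auto simp: lookup_add lookup_minus var_monomial_def lookup_single when_def)

lemma monomial_diff_eq_iff:
  assumes "0 < lk m' v"
  shows "m' - var_monomial v = m \<longleftrightarrow> m' = m + var_monomial v"
  using monomial_diff_add[OF assms] by (metis add_diff_cancel_right')

lemma lookup_partial:
  "lk (partial v g) m = real (lk m v + 1) * lk g (m + var_monomial v)"
proof -
  have "lk (partial v g) m = (\<Sum>m'\<in>Poly_Mapping.keys g.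
          if m' = m + var_monomial v then real (lk m' v) * lk g m' else 0)"
    unfolding partial_def lookup_sum
  proof (rule sum.cong)
    fix m' show "lk (Poly_Mapping.single (m' - var_monomial v) (real (lk m' v) * lk g m')) m
      = (if m' = m + var_monomial v then real (lk m' v) * lk g m' else 0)"
      \<comment> \<open>If x_v does not divide m', truncated subtraction yields a meaningless
        exponent vector, but the coefficient then carries the factor 0.\<close>
      by (cases "lk m' v = 0") (auto simp: lookup_single when_def monomial_diff_eq_iff)
  qed simp
  also have "\<dots> = real (lk m v + 1) * lk g (m + var_monomial v)"
    by (auto simp: in_keys_iff lookup_add var_monomial_def)
  finally show ?thesis .
qed

lemma partial_zero [simp]: "partial v 0 = 0"
  by (rule poly_mapping_eqI) (simp add: lookup_partial)

lemma partial_add: "partial v (f + g) = partial v f + partial v g"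
  by (rule poly_mapping_eqI) (simp add: lookup_partial lookup_add algebra_simps)

lemma partial_uminus: "partial v (- f) = - partial v f"
  by (rule poly_mapping_eqI) (simp add: lookup_partial)

lemma partial_sum: "partial v (\<Sum>i\<in>I. f i) = (\<Sum>i\<in>I. partial v (f i))"
  by (induction I rule: infinite_finite_induct) (auto simp: partial_add)

lemma partial_single:
  "partial v (Poly_Mapping.single m c) = Poly_Mapping.single (m - var_monomial v) (real (lk m v) * c)"
  by (auto simp: partial_def)

lemma partial_mult_single:
  "partial v (Poly_Mapping.single m c * Poly_Mapping.single m' c') =
   partial v (Poly_Mapping.single m c) * Poly_Mapping.single m' c'
   + Poly_Mapping.single m c * partial v (Poly_Mapping.single m' c')"
proof -
  have left: "(m + m') - var_monomial v = (m - var_monomial v) + m'" if "0 < lk m v"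
    by (subst monomial_diff_eq_iff)
       (use that monomial_diff_add[OF that] in \<open>auto simp: lookup_add ac_simps\<close>)
  have right: "(m + m') - var_monomial v = m + (m' - var_monomial v)" if "0 < lk m' v"
    by (subst monomial_diff_eq_iff)
       (use that monomial_diff_add[OF that] in \<open>auto simp: lookup_add ac_simps\<close>)
  show ?thesis
    by (cases "lk m v = 0"; cases "lk m' v = 0")
       (auto simp: partial_single mult_single lookup_add ring_distribs mult.assoc mult.left_commute
          left[symmetric] right[symmetric] single_add[symmetric])
qed

lemma partial_mult: "partial v (f * g) = partial v f * g + f * partial v g"
proof (induction f rule: rpoly_induct)
  case (add f m c)
  have "partial v (Poly_Mapping.single m c * g) =
        partial v (Poly_Mapping.single m c) * g + Poly_Mapping.single m c * partial v g"
    by (induction g rule: rpoly_induct) (auto simp: partial_add partial_mult_single algebra_simps)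
  with add show ?case by (simp add: partial_add algebra_simps)
qed simp

lemma partial_one [simp]: "partial v 1 = 0"
  by (rule poly_mapping_eqI)
     (auto simp: lookup_partial lookup_one when_def poly_mapping_eq_iff fun_eq_iff lookup_add
        var_monomial_def lookup_single)

lemma partial_prod:
  assumes "finite I"
  shows "partial v (\<Prod>i\<in>I. f i) = (\<Sum>j\<in>I. \<Prod>i\<in>I. if i = j then partial v (f i) else f i)"
  using assms
proof (induction I rule: finite_induct)
  case (insert x I)
  have "(\<Prod>i\<in>I. if i = x then partial v (f i) else f i) = (\<Prod>i\<in>I. f i)"
    by (rule prod.cong) (use insert in auto)
  moreover have "(\<Sum>j\<in>I. (if x = j then partial v (f x) else f x) *
        (\<Prod>i\<in>I. if i = j then partial v (f i) else f i))
      = f x * (\<Sum>j\<in>I. \<Prod>i\<in>I. if i = j then partial v (f i) else f i)"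
    unfolding sum_distrib_left by (rule sum.cong) (use insert in auto)
  ultimately show ?case using insert by (simp add: partial_mult)
qed simp

lemma partial_signof: "partial v (signof p * f) = signof p * partial v f"
  by (cases p rule: sign_cases) (auto simp: partial_uminus)

text \<open>Leibniz rule on each permutation product; interchanging the sum over permutations with
  the sum over the differentiated factor collects one determinant per row.\<close>

lemma partial_det:
  assumes A: "A \<in> carrier_mat k k"
  shows "partial v (det A) =
    (\<Sum>q<k. det (mat k k (\<lambda>(i, j). if i = q then partial v (A $$ (i, j)) else A $$ (i, j))))"
    (is "_ = (\<Sum>q<k. det (?A q))")
proof -
  have "det (?A q) = (\<Sum>p | p permutes {0..<k}. signof p *
      (\<Prod>i = 0..<k. if i = q then partial v (A $$ (i, p i)) else A $$ (i, p i)))" for q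
  proof -
    have "(\<Prod>i = 0..<k. ?A q $$ (i, p i)) =
        (\<Prod>i = 0..<k. if i = q then partial v (A $$ (i, p i)) else A $$ (i, p i))"
      if "p permutes {0..<k}" for p
      by (rule prod.cong) (use that permutes_in_image[OF that] in auto)
    then show ?thesis by (subst det_def'[of _ k]) auto
  qed
  then have "(\<Sum>q<k. det (?A q)) = (\<Sum>p | p permutes {0..<k}. signof p *
      (\<Sum>q<k. \<Prod>i = 0..<k. if i = q then partial v (A $$ (i, p i)) else A $$ (i, p i)))"
    by (simp add: sum_distrib_left) (rule sum.swap)
  then show ?thesis
    by (simp add: det_def'[OF A] partial_sum partial_signof partial_prod atLeast0LessThan)
qed

section \<open>The factorial-weighted pairing and its adjointness\<close>

definition monomial_fact :: "monomial \<Rightarrow> real" where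
  "monomial_fact m = (\<Prod>v\<in>Poly_Mapping.keys m. fact (lk m v))"

text \<open>The apolar product in the monomial basis, where its Gram matrix is diagonal with entries
  m! = \<open>monomial_fact m\<close>. It is real-valued for arbitrary polynomials, homogeneous or
  not. The gate goes into \<open>h\<close>, the minor into \<open>f\<close>.\<close>

definition pairing :: "rpoly \<Rightarrow> rpoly \<Rightarrow> real" where
  "pairing h f = (\<Sum>m\<in>Poly_Mapping.keys f. lk f m * (monomial_fact m * lk h m))"

lemma monomial_fact_superset:
  assumes "finite S" "Poly_Mapping.keys m \<subseteq> S"
  shows "monomial_fact m = (\<Prod>v\<in>S. fact (lk m v))"
  unfolding monomial_fact_def
  by (rule prod.mono_neutral_left) (use assms in \<open>auto simp: in_keys_iff\<close>)

lemma monomial_fact_zero [simp]: "monomial_fact 0 = 1"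
  by (simp add: monomial_fact_def)

lemma monomial_fact_add_var:
  "monomial_fact (m + var_monomial v) = real (lk m v + 1) * monomial_fact m"
proof -
  define S where "S = insert v (Poly_Mapping.keys m)"
  have S: "finite S" "v \<in> S" by (auto simp: S_def)
  have "Poly_Mapping.keys (m + var_monomial v) \<subseteq> S"
    using keys_add[of m "var_monomial v"] by (auto simp: S_def var_monomial_def split: if_splits)
  then have "monomial_fact (m + var_monomial v) = (\<Prod>u\<in>S. fact (lk (m + var_monomial v) u))"
    by (rule monomial_fact_superset[OF S(1)])
  also have "\<dots> = (\<Prod>u\<in>S. (if u = v then real (lk m v + 1) else 1) * fact (lk m u))"
    by (rule prod.cong) (auto simp: lookup_add var_monomial_def lookup_single when_def)
  also have "\<dots> = real (lk m v + 1) * (\<Prod>u\<in>S. fact (lk m u))"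
    using S by (simp add: prod.distrib)
  also have "(\<Prod>u\<in>S. fact (lk m u)) = monomial_fact m"
    by (rule monomial_fact_superset[symmetric]) (auto simp: S_def)
  finally show ?thesis .
qed

lemma pairing_superset:
  assumes "finite S" "Poly_Mapping.keys f \<subseteq> S"
  shows "pairing h f = (\<Sum>m\<in>S. lk f m * (monomial_fact m * lk h m))"
  unfolding pairing_def
  by (rule sum.mono_neutral_left) (use assms in \<open>auto simp: in_keys_iff\<close>)

lemma pairing_zero [simp]: "pairing h 0 = 0"
  by (simp add: pairing_def)

lemma pairing_add: "pairing h (f + g) = pairing h f + pairing h g"
proof -
  let ?S = "Poly_Mapping.keys f \<union> Poly_Mapping.keys g"
  show ?thesis
    using pairing_superset[of ?S f h] pairing_superset[of ?S g h] pairing_superset[of ?S "f + g" h]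
      keys_add[of f g]
    by (simp add: lookup_add sum.distrib algebra_simps)
qed

lemma pairing_single: "pairing h (Poly_Mapping.single m c) = c * (monomial_fact m * lk h m)"
  by (simp add: pairing_def)

lemma pairing_sum: "pairing h (\<Sum>i\<in>I. f i) = (\<Sum>i\<in>I. pairing h (f i))"
  by (induction I rule: infinite_finite_induct) (auto simp: pairing_add)

lemma pairing_const_mult: "pairing h (const c * f) = c * pairing h f"
  by (induction f rule: rpoly_induct)
     (auto simp: pairing_add pairing_single const_def mult_single algebra_simps)

lemma pairing_add_left: "pairing (h + h') f = pairing h f + pairing h' f"
  by (simp add: pairing_def lookup_add sum.distrib algebra_simps)

lemma lookup_const_mult: "lk (const c * h) m = c * lk h m"
  by (induction h rule: rpoly_induct)
     (auto simp: lookup_add const_def mult_single lookup_single when_def algebra_simps)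

lemma pairing_const_mult_left: "pairing (const c * h) f = c * pairing h f"
  by (simp add: pairing_def lookup_const_mult sum_distrib_left mult.left_commute)

lemma lookup_var_mult:
  "lk (var v * h) m = (if lk m v = 0 then 0 else lk h (m - var_monomial v))"
proof (induction h rule: rpoly_induct)
  case (add f m' c)
  have "(var_monomial v + m' = m) \<longleftrightarrow> lk m v \<noteq> 0 \<and> m' = m - var_monomial v"
  proof
    assume "var_monomial v + m' = m"
    then show "lk m v \<noteq> 0 \<and> m' = m - var_monomial v"
      by (auto simp: lookup_add var_monomial_def)
  next
    assume "lk m v \<noteq> 0 \<and> m' = m - var_monomial v"
    then show "var_monomial v + m' = m" using monomial_diff_add[of m v] by (simp add: add.commute)
  qed
  with add show ?case
    by (auto simp: lookup_add var_def mult_single algebra_simps lookup_single when_def)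
qed simp

text \<open>On a monomial m the factor \<open>lk m v\<close> produced by the derivative is the
  quotient of the factorial weights of m and m - \<open>var_monomial v\<close>.\<close>

lemma pairing_var_mult_left: "pairing (var v * h) f = pairing h (partial v f)"
proof (induction f rule: rpoly_induct)
  case (add f m c)
  have "pairing (var v * h) (Poly_Mapping.single m c) = pairing h (partial v (Poly_Mapping.single m c))"
  proof (cases "lk m v = 0")
    case False
    then have "monomial_fact m = real (lk m v) * monomial_fact (m - var_monomial v)"
      using monomial_fact_add_var[of "m - var_monomial v" v] monomial_diff_add[of m v]
      by (simp add: lookup_minus var_monomial_def)
    with False show ?thesis by (simp add: pairing_single lookup_var_mult partial_single)
  qed (simp add: pairing_single lookup_var_mult partial_single)
  with add show ?case by (simp add: pairing_add partial_add)
qed simp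

section \<open>Homogeneous polynomials and the comparison with the apolar product\<close>

definition homogeneous :: "nat \<Rightarrow> rpoly \<Rightarrow> bool" where
  "homogeneous d f \<longleftrightarrow> (\<forall>m\<in>Poly_Mapping.keys f. mdegree m = d)"

lemma forms_homogeneous: "f \<in> forms n d \<Longrightarrow> homogeneous d f"
  by (auto simp: forms_def homogeneous_def)

lemma mdegree_superset:
  assumes "finite S" "Poly_Mapping.keys m \<subseteq> S"
  shows "mdegree m = (\<Sum>v\<in>S. lk m v)"
  unfolding mdegree_def
  by (rule sum.mono_neutral_left) (use assms in \<open>auto simp: in_keys_iff\<close>)

lemma mdegree_add: "mdegree (m + m') = mdegree m + mdegree m'"
proof -
  let ?S = "Poly_Mapping.keys m \<union> Poly_Mapping.keys m'"
  show ?thesis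
    using mdegree_superset[of ?S m] mdegree_superset[of ?S m'] mdegree_superset[of ?S "m + m'"]
      keys_add[of m m']
    by (simp add: lookup_add sum.distrib)
qed

lemma mdegree_var_monomial: "mdegree (var_monomial v) = 1"
  by (simp add: mdegree_def var_monomial_def)

lemma mdegree_eq_0_iff: "mdegree m = 0 \<longleftrightarrow> m = 0"
proof
  assume "mdegree m = 0"
  then have "lk m v = 0" for v by (auto simp: mdegree_def in_keys_iff)
  then show "m = 0" by (intro poly_mapping_eqI) simp
qed (simp add: mdegree_def)

lemma homogeneous_mult:
  assumes "homogeneous d f" "homogeneous e g"
  shows "homogeneous (d + e) (f * g)"
  using assms keys_mult[of f g] by (auto simp: homogeneous_def mdegree_add)

lemma homogeneous_sum:
  assumes "\<And>i. i \<in> I \<Longrightarrow> homogeneous d (f i)"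
  shows "homogeneous d (\<Sum>i\<in>I. f i)"
  using assms keys_sum[of f I] by (fastforce simp: homogeneous_def)

lemma homogeneous_one: "homogeneous 0 1"
  by (simp add: homogeneous_def mdegree_def)

lemma homogeneous_prod:
  assumes "finite I" "\<And>i. i \<in> I \<Longrightarrow> homogeneous 1 (f i)"
  shows "homogeneous (card I) (\<Prod>i\<in>I. f i)"
  using assms
proof (induction I rule: finite_induct)
  case (insert x I)
  then show ?case using homogeneous_mult[of 1 "f x" "card I"] by auto
qed (simp add: homogeneous_one)

lemma homogeneous_uminus: "homogeneous d (- f) = homogeneous d f"
  by (simp add: homogeneous_def)

lemma homogeneous_det:
  assumes A: "A \<in> carrier_mat k k"
    and lin: "\<And>i j. i < k \<Longrightarrow> j < k \<Longrightarrow> homogeneous 1 (A $$ (i, j))"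
  shows "homogeneous k (det A)"
  unfolding det_def'[OF A]
proof (rule homogeneous_sum)
  fix p assume "p \<in> {p. p permutes {0..<k}}"
  then have p: "p permutes {0..<k}" by simp
  have "homogeneous (card {0..<k}) (\<Prod>i = 0..<k. A $$ (i, p i))"
    by (rule homogeneous_prod) (use lin permutes_in_image[OF p] in auto)
  then show "homogeneous k (signof p * (\<Prod>i = 0..<k. A $$ (i, p i)))"
    by (cases p rule: sign_cases) (auto simp: homogeneous_uminus)
qed

text \<open>A monomial m + \<open>var_monomial v\<close> has degree one only for m = 0.\<close>

lemma partial_linear_form:
  assumes "homogeneous 1 f"
  shows "partial v f = const (lk f (var_monomial v))"
proof (rule poly_mapping_eqI)
  fix m
  show "lk (partial v f) m = lk (const (lk f (var_monomial v))) m"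
  proof (cases "m = 0")
    case False
    then have "mdegree (m + var_monomial v) \<noteq> 1"
      by (simp add: mdegree_add mdegree_var_monomial mdegree_eq_0_iff)
    then have "lk f (m + var_monomial v) = 0"
      using assms by (auto simp: homogeneous_def in_keys_iff)
    with False show ?thesis by (simp add: lookup_partial const_def lookup_single)
  qed (simp add: lookup_partial const_def lookup_single)
qed

text \<open>Weighting by m! absorbs the falling factorials of repeated differentiation, so the
  induction carries no products; at m = 0 the right-hand side is already a summand of the
  pairing.\<close>

lemma lookup_partial_pow:
  "lk ((partial v ^^ k) g) m * monomial_fact m =
   monomial_fact (m + Poly_Mapping.single v k) * lk g (m + Poly_Mapping.single v k)"
proof (induction k arbitrary: m)
  case (Suc k)
  have eq: "m + Poly_Mapping.single v (Suc k) = (m + var_monomial v) + Poly_Mapping.single v k"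
    by (simp add: var_monomial_def ac_simps flip: single_add)
  have "lk ((partial v ^^ Suc k) g) m * monomial_fact m =
      lk ((partial v ^^ k) g) (m + var_monomial v) * monomial_fact (m + var_monomial v)"
    by (simp add: lookup_partial monomial_fact_add_var)
  then show ?case by (simp add: Suc.IH eq)
qed simp

lemma lookup_fold_partial:
  "lk (fold (\<lambda>v. partial v ^^ e v) vs g) m * monomial_fact m =
   monomial_fact (m + (\<Sum>v\<leftarrow>vs. Poly_Mapping.single v (e v))) *
   lk g (m + (\<Sum>v\<leftarrow>vs. Poly_Mapping.single v (e v)))"
proof (induction vs arbitrary: g m)
  case (Cons v vs)
  have "lk (fold (\<lambda>v. partial v ^^ e v) (v # vs) g) m * monomial_fact m =
      lk ((partial v ^^ e v) g) (m + (\<Sum>v\<leftarrow>vs. Poly_Mapping.single v (e v))) *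
      monomial_fact (m + (\<Sum>v\<leftarrow>vs. Poly_Mapping.single v (e v)))"
    using Cons.IH[of "(partial v ^^ e v) g" m] by (simp add: mult.commute)
  then show ?case by (simp only: lookup_partial_pow) (simp add: ac_simps)
qed simp

lemma lookup_partial_monomial:
  "lk (partial_monomial m g) m' * monomial_fact m' = monomial_fact (m' + m) * lk g (m' + m)"
proof -
  have "(\<Sum>v\<leftarrow>sorted_list_of_set (Poly_Mapping.keys m). Poly_Mapping.single v (lk m v)) =
        (\<Sum>v\<in>Poly_Mapping.keys m. Poly_Mapping.single v (lk m v))"
    by (simp add: sum_list_distinct_conv_sum_set)
  also have "\<dots> = m"
    by (rule poly_mapping_eqI) (auto simp: lookup_sum lookup_single when_def in_keys_iff)
  finally show ?thesis
    using lookup_fold_partial[of "lk m" "sorted_list_of_set (Poly_Mapping.keys m)" g m']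
    by (simp add: partial_monomial_def)
qed

text \<open>Equal degrees are essential: a derivative of order d leaves only a constant of a form of
  degree d, because a coefficient at m' + m with m' nonzero would have too large a degree.\<close>

lemma apolar_eq_pairing:
  assumes "homogeneous d f" "homogeneous d g"
  shows "apolar f g = const (pairing g f)"
proof -
  have "partial_monomial m g = const (monomial_fact m * lk g m)" if "m \<in> Poly_Mapping.keys f" for m
  proof (rule poly_mapping_eqI)
    fix m'
    have deg: "mdegree m = d" using that assms by (auto simp: homogeneous_def)
    show "lk (partial_monomial m g) m' = lk (const (monomial_fact m * lk g m)) m'"
    proof (cases "m' = 0")
      case True
      then show ?thesis using lookup_partial_monomial[of m g 0] by (simp add: const_def)
    next
      case False
      then have "mdegree (m' + m) \<noteq> d" by (simp add: mdegree_add deg mdegree_eq_0_iff)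
      then have "lk g (m' + m) = 0" using assms by (auto simp: homogeneous_def in_keys_iff)
      moreover have "monomial_fact m' \<noteq> 0" by (simp add: monomial_fact_def)
      ultimately show ?thesis using lookup_partial_monomial[of m g m'] False
        by (simp add: const_def lookup_single)
    qed
  qed
  then have "apolar f g =
      (\<Sum>m\<in>Poly_Mapping.keys f. const (lk f m) * const (monomial_fact m * lk g m))"
    by (simp add: apolar_def)
  also have "\<dots> = const (pairing g f)"
    unfolding pairing_def const_def
    by (rule poly_mapping_eqI) (auto simp: mult_single lookup_sum lookup_single when_def)
  finally show ?thesis .
qed


section \<open>Row-deleted Hankel minors\<close>

text \<open>Rows are functions on all naturals of which only the first \<open>length fs\<close>
  values enter. This allows reading a row one place further, or with a position skipped by
  \<open>insert_index\<close>, without changing its type.\<close>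

definition det_rows :: "(nat \<Rightarrow> 'a) list \<Rightarrow> 'a::comm_ring_1" where
  "det_rows fs = det (mat (length fs) (length fs) (\<lambda>(q, p). (fs ! q) p))"

text \<open>Laplace expansion along the distinguished row: the cofactors are taken from the
  remaining rows and so do not depend on f or g.\<close>

lemma det_rows_linear:
  "det_rows (A @ (\<lambda>p. f p + z * g p) # C) = det_rows (A @ f # C) + z * det_rows (A @ g # C)"
proof -
  define n q where "n = length A + Suc (length C)" and "q = length A"
  define M where "M h = mat n n (\<lambda>(i, j). ((A @ h # C) ! i) j)" for h
  define co where "co j = cofactor (M f) q j" for j
  have M: "M h \<in> carrier_mat n n" "det_rows (A @ h # C) = det (M h)" for h
    by (simp_all add: M_def det_rows_def n_def)
  have q: "q < n" by (simp add: n_def q_def)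
  have minor: "mat_delete (M h) q j = mat_delete (M f) q j" for h j
    by (rule eq_matI) (auto simp: mat_delete_def M_def nth_append nth_Cons q_def split: nat.split)
  have "cofactor (M h) q j = co j" for h j
    unfolding cofactor_def co_def by (simp only: minor[of h])
  then have "det_rows (A @ h # C) = (\<Sum>j<n. h j * co j)" for h
    using laplace_expansion_row[OF M(1) q] q by (simp add: M) (simp add: M_def q_def)
  then show ?thesis by (simp add: algebra_simps sum.distrib sum_distrib_left)
qed

lemma det_rows_const_poly:
  "det_rows (map (\<lambda>f p. [:f p:]) fs) = [:det_rows fs:]"
proof -
  interpret comm_ring_hom "\<lambda>x::'a. [:x:]" by unfold_locales auto
  show ?thesis unfolding det_rows_def hom_det[symmetric]
    by (intro arg_cong[where f = det] eq_matI) auto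
qed

lemma det_rows_not_distinct:
  assumes "\<not> distinct fs"
  shows "det_rows fs = 0"
proof -
  from assms obtain i j where ij: "i \<noteq> j" "i < length fs" "j < length fs" "fs ! i = fs ! j"
    by (auto simp: distinct_conv_nth)
  show ?thesis unfolding det_rows_def
    by (rule det_identical_rows[OF _ ij(1-3)]) (use ij in auto)
qed

text \<open>Prepend the row \<open>(-z)\<^sup>k, \<dots>, -z, 1\<close> and add \<open>z\<close> times each column to its predecessor: the
  two Laplace expansions along the new row are the two sides.\<close>

lemma det_rows_add_shifted:
  "det_rows (map (\<lambda>f p. f p + z * f (Suc p)) fs) =
   (\<Sum>p\<le>length fs. z ^ (length fs - p) * det_rows (map (\<lambda>f j. f (insert_index p j)) fs))"
proof -
  define k where "k = length fs"
  define N where "N = mat (Suc k) (Suc k) (\<lambda>(q, p). if q = 0 then (- z) ^ (k - p) else (fs ! (q - 1)) p)"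
  \<comment> \<open>Right multiplication by this lower unitriangular matrix adds z times each column
    to its predecessor and preserves the determinant.\<close>
  define U where "U = mat (Suc k) (Suc k) (\<lambda>(i, p). if i = p then 1 else if i = Suc p then z else 0)"
  have carr: "N \<in> carrier_mat (Suc k) (Suc k)" "U \<in> carrier_mat (Suc k) (Suc k)"
      "N * U \<in> carrier_mat (Suc k) (Suc k)"
    by (auto simp: N_def U_def)
  have "diag_mat U = map (\<lambda>_. 1) [0..<Suc k]"
    unfolding diag_mat_def by (rule map_cong) (auto simp: U_def)
  then have "prod_list (diag_mat U) = 1" by (simp only: prod_list_replicate map_replicate_const power_one)
  then have "det U = 1"
    by (subst det_lower_triangular[OF _ carr(2)]) (auto simp: U_def)
  then have det_NU: "det (N * U) = det N"
    by (simp add: det_mult[OF carr(1,2)])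
  have NU: "(N * U) $$ (q, p) = N $$ (q, p) + (if p < k then z * N $$ (q, Suc p) else 0)"
    if "q < Suc k" "p < Suc k" for q p
  proof -
    have "(N * U) $$ (q, p) = (\<Sum>i\<in>{0..<Suc k}. N $$ (q, i) * U $$ (i, p))"
      using that carr by (simp add: scalar_prod_def)
    also have "\<dots> = (\<Sum>i\<in>{0..<Suc k}. (if i = p then N $$ (q, i) else 0) +
        (if i = Suc p then z * N $$ (q, i) else 0))"
      by (rule sum.cong) (use that in \<open>auto simp: U_def\<close>)
    also have "\<dots> = N $$ (q, p) + (if p < k then z * N $$ (q, Suc p) else 0)"
      unfolding sum.distrib using that by (auto simp: less_Suc_eq)
    finally show ?thesis .
  qed
  \<comment> \<open>The new row is built to cancel: (-z)^(k-p) + z (-z)^(k-p-1) = 0 for p < k. Only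
    its last entry 1 survives, so the expansion of N * U has a single term.\<close>
  have row0: "(N * U) $$ (0, p) = (if p = k then 1 else 0)" if "p < Suc k" for p
  proof (cases "p = k")
    case False
    then have "k - p = Suc (k - Suc p)" using that by simp
    then show ?thesis using that False by (simp add: NU) (simp add: N_def)
  qed (simp add: NU, simp add: N_def)
  have "det (N * U) = cofactor (N * U) 0 k"
    by (subst laplace_expansion_row[OF carr(3), of 0]) (auto simp: row0 if_distrib cong: if_cong)
  also have "mat_delete (N * U) 0 k =
      mat k k (\<lambda>(q, p). (map (\<lambda>f p. f p + z * f (Suc p)) fs ! q) p)"
  proof (rule eq_matI)
    fix i j assume "i < dim_row (mat k k (\<lambda>(q, p). (map (\<lambda>f p. f p + z * f (Suc p)) fs ! q) p))"
      "j < dim_col (mat k k (\<lambda>(q, p). (map (\<lambda>f p. f p + z * f (Suc p)) fs ! q) p))"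
    then have ij: "i < k" "j < k" by auto
    then have "mat_delete (N * U) 0 k $$ (i, j) = (N * U) $$ (Suc i, j)"
      using carr by (simp add: mat_delete_def)
    also have "\<dots> = N $$ (Suc i, j) + z * N $$ (Suc i, Suc j)"
      using ij by (simp add: NU)
    finally show "mat_delete (N * U) 0 k $$ (i, j) =
        mat k k (\<lambda>(q, p). (map (\<lambda>f p. f p + z * f (Suc p)) fs ! q) p) $$ (i, j)"
      using ij by (simp add: N_def k_def)
  qed (use carr in auto)
  then have "cofactor (N * U) 0 k = (-1) ^ k * det_rows (map (\<lambda>f p. f p + z * f (Suc p)) fs)"
    by (simp add: cofactor_def det_rows_def k_def)
  finally have lhs: "det N = (-1) ^ k * det_rows (map (\<lambda>f p. f p + z * f (Suc p)) fs)"
    using det_NU by simp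
  have "mat_delete N 0 p = mat k k (\<lambda>(q, j). (map (\<lambda>f j. f (insert_index p j)) fs ! q) j)" for p
    by (rule eq_matI) (auto simp: mat_delete_def N_def insert_index_def k_def)
  then have "cofactor N 0 p = (-1) ^ p * det_rows (map (\<lambda>f j. f (insert_index p j)) fs)" for p
    by (simp add: cofactor_def det_rows_def k_def)
  then have "det N = (\<Sum>p<Suc k. (- z) ^ (k - p) * ((-1) ^ p * det_rows (map (\<lambda>f j. f (insert_index p j)) fs)))"
    by (subst laplace_expansion_row[OF carr(1), of 0]) (auto simp: N_def)
  \<comment> \<open>The factor (-1)^k clears the sign on the left; on the right, split as (-1)^(k-p)
    (-1)^p, it cancels the signs of (-z)^(k-p) and of the cofactor.\<close>
  then have "(-1) ^ k * ((-1) ^ k * det_rows (map (\<lambda>f p. f p + z * f (Suc p)) fs)) =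
      (\<Sum>p<Suc k. (-1) ^ k * ((- z) ^ (k - p) * ((-1) ^ p * det_rows (map (\<lambda>f j. f (insert_index p j)) fs))))"
    unfolding lhs by (simp only: sum_distrib_left)
  also have "\<dots> = (\<Sum>p<Suc k. z ^ (k - p) * det_rows (map (\<lambda>f j. f (insert_index p j)) fs))"
  proof (rule sum.cong)
    fix p assume "p \<in> {..<Suc k}"
    then have "(-1) ^ k = (-1 :: 'a) ^ (k - p) * (-1) ^ p" by (simp flip: power_add)
    moreover have "(-1) ^ p * (-1) ^ p = (1 :: 'a)" "(-1) ^ (k - p) * (-1) ^ (k - p) = (1 :: 'a)"
      by (simp_all flip: power_mult_distrib)
    moreover have "(- z) ^ (k - p) = (-1) ^ (k - p) * z ^ (k - p)"
      by (rule power_minus)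
    moreover have "(s * t) * ((s * Z) * (t * D)) = ((s * s) * (t * t)) * (Z * D)" for s t Z D :: 'a
      by (simp only: mult_ac)
    ultimately show "(-1) ^ k * ((- z) ^ (k - p) * ((-1) ^ p * det_rows (map (\<lambda>f j. f (insert_index p j)) fs)))
        = z ^ (k - p) * det_rows (map (\<lambda>f j. f (insert_index p j)) fs)"
      by (simp only: mult_1_left)
  qed simp
  also have "(-1) ^ k * ((-1) ^ k * det_rows (map (\<lambda>f p. f p + z * f (Suc p)) fs)) =
      det_rows (map (\<lambda>f p. f p + z * f (Suc p)) fs)"
    by (simp flip: mult.assoc power_mult_distrib)
  finally show ?thesis by (simp add: k_def lessThan_Suc_atMost)
qed

text \<open>The Pieri-type sum: exactly r of the columns in A move by one, while those in C are
  final. It is used with A in descending order, so that prepending to C restores the ascending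
  order. Repeated columns are allowed, as their minors vanish.\<close>

fun shift_sum :: "(nat list \<Rightarrow> 'a::comm_monoid_add) \<Rightarrow> nat list \<Rightarrow> nat list \<Rightarrow> nat \<Rightarrow> 'a" where
  "shift_sum f [] C r = (if r = 0 then f C else 0)"
| "shift_sum f (x # A) C r =
     shift_sum f A (x # C) r + (if r = 0 then 0 else shift_sum f A (Suc x # C) (r - 1))"

text \<open>Stored transposed: a chosen column c of the Hankel matrix becomes the row p -> a (c +
  p). Shifting a column is then shifting the argument of a row function, and deleting a Hankel row
  is skipping a position p. The sequence a lists the antidiagonals.\<close>

definition hankel_minor :: "(nat \<Rightarrow> 'a) \<Rightarrow> nat list \<Rightarrow> 'a::comm_ring_1" where
  "hankel_minor a cs = det_rows (map (\<lambda>c p. a (c + p)) cs)"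

lemma hankel_minor_not_distinct: "\<not> distinct cs \<Longrightarrow> hankel_minor a cs = 0"
  unfolding hankel_minor_def by (rule det_rows_not_distinct) (auto simp: distinct_map)

text \<open>Multilinearity, one row at a time: the row of x splits into the unshifted row and z
  times the shifted one, so the exponent of z counts the shifts. Reversing A puts the row to be
  split next to the rows already decided.\<close>

lemma coeff_det_rows_shift:
  "coeff (det_rows (map (\<lambda>c p. [:a (c + p):] + [:0, 1:] * [:a (Suc (c + p)):]) (rev A) @
     map (\<lambda>c p. [:a (c + p):]) C)) r = shift_sum (hankel_minor a) A C r"
proof (induction A arbitrary: C r)
  case Nil
  have "map (\<lambda>c p. [:a (c + p):]) C = map (\<lambda>f p. [:f p:]) (map (\<lambda>c p. a (c + p)) C)" by simp
  then show ?case
    by (simp only: rev.simps list.map append_Nil det_rows_const_poly flip: hankel_minor_def)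
       (simp add: coeff_pCons split: nat.split)
next
  case (Cons x A)
  let ?A = "map (\<lambda>c p. [:a (c + p):] + [:0, 1:] * [:a (Suc (c + p)):]) (rev A)"
  let ?C = "map (\<lambda>c p. [:a (c + p):])"
  have "det_rows (map (\<lambda>c p. [:a (c + p):] + [:0, 1:] * [:a (Suc (c + p)):]) (rev (x # A)) @ ?C C)
      = det_rows (?A @ ?C (x # C)) + [:0, 1:] * det_rows (?A @ ?C (Suc x # C))"
    using det_rows_linear[of ?A "\<lambda>p. [:a (x + p):]" "[:0, 1:]" "\<lambda>p. [:a (Suc (x + p)):]" "?C C"]
    by simp
  moreover have "coeff ([:0, 1:] * P) r = (if r = 0 then 0 else coeff P (r - 1))" for P :: "'a poly"
    by (simp add: coeff_pCons split: nat.split)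
  ultimately show ?case
    by (simp only: coeff_add Cons.IH shift_sum.simps)
qed

text \<open>Pieri's rule for \<open>e\<^sub>r\<close>, in the guise of a linear relation between Hankel minors: deleting a row
  amounts to shifting columns.\<close>

lemma hankel_minor_insert_index:
  assumes "i \<le> length cs"
  shows "det_rows (map (\<lambda>c j. a (c + insert_index i j)) cs) =
    shift_sum (hankel_minor a) (rev cs) [] (length cs - i)"
proof -
  let ?k = "length cs"
  define m where "m p = det_rows (map (\<lambda>c j. a (c + insert_index p j)) cs)" for p
  have m: "det_rows (map (\<lambda>f j. f (insert_index p j)) (map (\<lambda>c p. [:a (c + p):]) cs)) = [:m p:]" for p
    unfolding m_def det_rows_const_poly[symmetric] by (simp add: comp_def)
  \<comment> \<open>Both sides are the coefficient of z^(k-i), where z is \<open>[:0, 1:]\<close>,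
    in the same determinant: expanded by multilinearity on the left, by
    \<open>det_rows_add_shifted\<close> on the right.\<close>
  have "shift_sum (hankel_minor a) (rev cs) [] (?k - i) =
      coeff (det_rows (map (\<lambda>f p. f p + [:0, 1:] * f (Suc p)) (map (\<lambda>c p. [:a (c + p):]) cs))) (?k - i)"
    using coeff_det_rows_shift[of a "rev cs" "[]" "?k - i"] by (simp add: comp_def)
  also have "\<dots> = (\<Sum>p\<le>?k. coeff ([:0, 1:] ^ (?k - p) * [:m p:]) (?k - i))"
    unfolding det_rows_add_shifted m by (simp add: coeff_sum)
  also have "\<dots> = (\<Sum>p\<le>?k. if p = i then m p else 0)"
  proof (rule sum.cong)
    fix p assume "p \<in> {..?k}"
    moreover have "[:0, 1:] ^ n * [:x:] = monom x n" for n and x :: 'a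
      by (induction n) (auto simp: monom_0 monom_Suc)
    ultimately show "coeff ([:0, 1:] ^ (?k - p) * [:m p:]) (?k - i) = (if p = i then m p else 0)"
      using assms by auto
  qed simp
  also have "\<dots> = m i" using assms by simp
  finally show ?thesis by (simp add: m_def)
qed

lemma pairing_shift_sum:
  "pairing h (shift_sum f A C r) = shift_sum (\<lambda>C. pairing h (f C)) A C r"
  by (induction A arbitrary: C r) (auto simp: pairing_add)

lemma const_sign_mult: "(-1) ^ n * const x = const ((-1) ^ n * x)"
  by (cases "even n") (auto simp: const_def single_uminus)

text \<open>Differentiating row q leaves constants there, so the Laplace expansion along it yields
  minors without column \<open>cs ! q\<close> and without Hankel row p. Skipping row p of k rows
  amounts to k - 1 - p column shifts, the number of rows after it.\<close>

lemma partial_hankel_minor: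
  assumes a: "\<And>m. partial v (a m) = const (l m)"
  shows "partial v (hankel_minor a cs) = (\<Sum>q<length cs. \<Sum>p<length cs.
    const ((-1) ^ (q + p) * l (cs ! q + p)) *
    shift_sum (hankel_minor a) (rev (take q cs @ drop (Suc q) cs)) [] (length cs - 1 - p))"
proof -
  define k where "k = length cs"
  define A where "A = mat k k (\<lambda>(q, p). a (cs ! q + p))"
  define D where "D q = mat k k (\<lambda>(i, j). if i = q then partial v (A $$ (i, j)) else A $$ (i, j))" for q
  have A: "A \<in> carrier_mat k k" and D: "D q \<in> carrier_mat k k" for q
    by (auto simp: A_def D_def)
  have "mat k k (\<lambda>(q, p). (map (\<lambda>c p. a (c + p)) cs ! q) p) = A"
    by (rule eq_matI) (auto simp: A_def k_def)
  then have "hankel_minor a cs = det A"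
    by (simp add: hankel_minor_def det_rows_def k_def)
  then have "partial v (hankel_minor a cs) = (\<Sum>q<k. det (D q))"
    by (simp add: partial_det[OF A] D_def)
  also have "\<dots> = (\<Sum>q<k. \<Sum>p<k. const ((-1) ^ (q + p) * l (cs ! q + p)) *
    shift_sum (hankel_minor a) (rev (take q cs @ drop (Suc q) cs)) [] (k - 1 - p))"
  proof (rule sum.cong)
    fix q assume "q \<in> {..<k}"
    then have q: "q < k" by simp
    let ?cs = "take q cs @ drop (Suc q) cs"
    have len: "length ?cs = k - 1" using q by (simp add: k_def)
    show "det (D q) = (\<Sum>p<k. const ((-1) ^ (q + p) * l (cs ! q + p)) *
      shift_sum (hankel_minor a) (rev ?cs) [] (k - 1 - p))"
    proof (subst laplace_expansion_row[OF D q], rule sum.cong)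
      fix p assume "p \<in> {..<k}"
      then have p: "p < k" by simp
      have "mat_delete (D q) q p = mat (k - 1) (k - 1)
          (\<lambda>(i, j). (map (\<lambda>c j. a (c + insert_index p j)) ?cs ! i) j)"
      proof (rule eq_matI)
        fix i j assume "i < dim_row (mat (k - 1) (k - 1)
            (\<lambda>(i, j). (map (\<lambda>c j. a (c + insert_index p j)) ?cs ! i) j))"
          "j < dim_col (mat (k - 1) (k - 1)
            (\<lambda>(i, j). (map (\<lambda>c j. a (c + insert_index p j)) ?cs ! i) j))"
        then have ij: "i < k - 1" "j < k - 1" by auto
        have "?cs ! i = cs ! (if i < q then i else Suc i)"
          using ij q by (auto simp: nth_append k_def)
        moreover have "map (\<lambda>c j. a (c + insert_index p j)) ?cs ! i = (\<lambda>j. a (?cs ! i + insert_index p j))"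
          using ij len by (subst nth_map) auto
        ultimately show "mat_delete (D q) q p $$ (i, j) = mat (k - 1) (k - 1)
            (\<lambda>(i, j). (map (\<lambda>c j. a (c + insert_index p j)) ?cs ! i) j) $$ (i, j)"
          using ij p by (auto simp: mat_delete_def D_def A_def insert_index_def)
      qed (auto simp: D_def)
      then have "det (mat_delete (D q) q p) = det_rows (map (\<lambda>c j. a (c + insert_index p j)) ?cs)"
        using len by (simp add: det_rows_def)
      also have "\<dots> = shift_sum (hankel_minor a) (rev ?cs) [] (k - 1 - p)"
        using p hankel_minor_insert_index[of p ?cs a] len by simp
      finally show "D q $$ (q, p) * cofactor (D q) q p = const ((-1) ^ (q + p) * l (cs ! q + p)) *
          shift_sum (hankel_minor a) (rev ?cs) [] (k - 1 - p)"
        using p q by (simp add: cofactor_def flip: const_sign_mult) (simp add: D_def A_def a)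
    qed simp
  qed simp
  finally show ?thesis by (simp add: k_def)
qed


section \<open>Minors indexed by bit masks\<close>

text \<open>Recursion on w div 2 is the recurrence by which the program fills its own table from
  earlier entries.\<close>

fun popcount :: "nat \<Rightarrow> nat" where
  "popcount w = (if w = 0 then 0 else popcount (w div 2) + w mod 2)"

declare popcount.simps [simp del]

lemma popcount_0 [simp]: "popcount 0 = 0"
  by (simp add: popcount.simps)

lemma popcount_rec: "popcount w = popcount (w div 2) + w mod 2"
  by (cases "w = 0") (simp_all add: popcount.simps[of w])

definition columns :: "nat \<Rightarrow> nat \<Rightarrow> nat list" where
  "columns n w = filter (bit w) [0..<n]"

lemma filter_upt_Suc:
  "filter P [0..<Suc n] = (if P 0 then [0] else []) @ map Suc (filter (\<lambda>i. P (Suc i)) [0..<n])"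
  by (simp add: upt_conv_Cons filter_map comp_def flip: map_Suc_upt del: upt_Suc)

lemma length_columns: "w < 2 ^ n \<Longrightarrow> length (columns n w) = popcount w"
proof (induction n arbitrary: w)
  case (Suc n)
  have "length (columns (Suc n) w) = w mod 2 + length (columns n (w div 2))"
    unfolding columns_def filter_upt_Suc by (auto simp: bit_Suc bit_0 odd_iff_mod_2_eq_one)
  also have "length (columns n (w div 2)) = popcount (w div 2)"
    by (rule Suc.IH) (use Suc.prems in auto)
  finally show ?case using popcount_rec[of w] by simp
qed (simp add: columns_def)

lemma bit_mod_power: "bit (w mod 2 ^ b :: nat) c \<longleftrightarrow> c < b \<and> bit w c"
  using bit_take_bit_iff[of b w c] by (simp add: take_bit_eq_mod)

text \<open>The number of set bits below b is the position of column b among the columns of w when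
  bit b is set; the Laplace sign needs it, and the program finds it by one table lookup.\<close>

lemma popcount_mod: "popcount (w mod 2 ^ b) = length (columns b w)"
proof -
  have "columns b (w mod 2 ^ b) = columns b w"
    unfolding columns_def by (rule filter_cong) (auto simp: bit_mod_power)
  then show ?thesis using length_columns[of "w mod 2 ^ b" b] by simp
qed

lemma less_power_iff_bits: "(w::nat) < 2 ^ n \<longleftrightarrow> (\<forall>b. bit w b \<longrightarrow> b < n)"
proof -
  have "w < 2 ^ n \<longleftrightarrow> take_bit n w = w"
    by (simp add: take_bit_nat_eq_self_iff)
  also have "\<dots> \<longleftrightarrow> (\<forall>b. bit w b \<longrightarrow> b < n)"
    by (auto simp: bit_eq_iff bit_take_bit_iff)
  finally show ?thesis .
qed

lemma minus_power_eq_unset_bit: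
  assumes "bit w b"
  shows "w - 2 ^ b = unset_bit b (w::nat)"
proof -
  have "w = set_bit b (unset_bit b w)"
    using assms by (intro bit_eqI) (auto simp: bit_set_bit_iff bit_unset_bit_iff)
  also have "\<dots> = unset_bit b w + 2 ^ b"
    by (simp add: set_bit_eq bit_unset_bit_iff)
  finally show ?thesis by simp
qed

text \<open>The program has only arithmetic on masks: moving a bit to the free position above it is
  subtracting 2^b and adding 2^(b+1), in total adding 2^b.\<close>

lemma plus_power_eq_set_bit:
  assumes "bit w b" "\<not> bit w (Suc b)"
  shows "w + 2 ^ b = set_bit (Suc b) (unset_bit b (w::nat))"
proof -
  have "2 ^ b \<le> w"
    using assms by (metis bit_iff_odd div_less even_zero leI)
  moreover have "\<not> bit (w - 2 ^ b) (Suc b)"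
    using assms by (simp add: minus_power_eq_unset_bit bit_unset_bit_iff)
  ultimately show ?thesis
    using assms by (simp add: set_bit_eq flip: minus_power_eq_unset_bit)
qed

section \<open>Admissible masks and their Fibonacci count\<close>

text \<open>The bits of \<open>w\<close> are the columns of a maximal minor of the Hankel matrix with
  \<open>popcount w\<close> rows and \<open>n - popcount w\<close> columns; here \<open>n = 2 d\<close>.\<close>

definition admissible :: "nat \<Rightarrow> nat \<Rightarrow> bool" where
  "admissible n w \<longleftrightarrow> w < 2 ^ (n - popcount w)"

lemma admissible_less: "admissible n w \<Longrightarrow> w < 2 ^ n"
  unfolding admissible_def
  by (rule less_le_trans[of _ "2 ^ (n - popcount w)"]) auto

lemma admissible_columns:
  assumes "w < 2 ^ n"
  shows "admissible n w \<longleftrightarrow> (\<forall>b\<in>set (columns n w). b < n - length (columns n w))"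
proof -
  have "set (columns n w) = {b. bit w b}"
    using assms by (auto simp: columns_def less_power_iff_bits)
  then show ?thesis
    by (simp add: admissible_def length_columns[OF assms] less_power_iff_bits)
qed

lemma finite_admissible: "finite {w. admissible n w}"
  by (rule finite_subset[of _ "{..<2 ^ n}"]) (auto dest: admissible_less)

text \<open>Dropping an unset lowest bit removes one column and no row. When popcount exceeds n,
  truncated subtraction makes the bounds 2^0, and both sides fail because u is nonzero.\<close>

lemma admissible_double: "admissible (Suc n) (2 * u) \<longleftrightarrow> admissible n u"
proof (cases "popcount u \<le> n")
  case True
  have "popcount (2 * u) = popcount u" by (subst popcount_rec) simp
  with True show ?thesis by (simp add: admissible_def Suc_diff_le)
next
  case False
  then have "u \<noteq> 0" by (intro notI) simp
  have "popcount (2 * u) = popcount u" by (subst popcount_rec) simp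
  with False \<open>u \<noteq> 0\<close> show ?thesis by (simp add: admissible_def)
qed

text \<open>Dropping a set lowest bit removes a column and, through the smaller popcount, also a
  row; hence the width drops by two.\<close>

lemma admissible_double_Suc: "admissible (Suc (Suc n)) (2 * u + 1) \<longleftrightarrow> admissible n u"
proof (cases "popcount u \<le> n")
  case True
  have "popcount (2 * u + 1) = Suc (popcount u)" by (subst popcount_rec) simp
  then have "admissible (Suc (Suc n)) (2 * u + 1) \<longleftrightarrow> 2 * u + 1 < 2 * 2 ^ (n - popcount u)"
    using True by (simp add: admissible_def Suc_diff_le)
  then show ?thesis unfolding admissible_def by linarith
next
  case False
  then have "u \<noteq> 0" by (intro notI) simp
  have "popcount (2 * u + 1) = Suc (popcount u)" by (subst popcount_rec) simp
  with False \<open>u \<noteq> 0\<close> show ?thesis by (simp add: admissible_def)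
qed

lemma golden_ratio_square: "golden_ratio ^ 2 = golden_ratio + 1"
  by (simp add: golden_ratio_def power2_eq_square field_simps)

lemma golden_ratio_ge_1: "1 \<le> golden_ratio"
  by (simp add: golden_ratio_def)

text \<open>Splitting by parity gives the Fibonacci recurrence as an upper bound; the powers of
  \<open>golden_ratio\<close> satisfy it with equality, and both base counts are 1.\<close>

lemma card_admissible: "real (card {w. admissible n w}) \<le> golden_ratio ^ n"
proof (induction n rule: induct_nat_012)
  case 0
  have "{w. admissible 0 w} = {0}" by (auto simp: admissible_def)
  then show ?case by simp
next
  case 1
  have "{w. admissible (Suc 0) w} = {0}"
  proof (intro equalityI subsetI)
    fix w assume w: "w \<in> {w. admissible (Suc 0) w}"
    then have "w = 0 \<or> w = 1" using admissible_less[of "Suc 0" w] by auto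
    moreover have "popcount 1 = 1" by (simp add: popcount.simps)
    then have "\<not> admissible (Suc 0) 1" by (simp add: admissible_def)
    ultimately show "w \<in> {0}" using w by auto
  qed (simp add: admissible_def)
  then show ?case using golden_ratio_ge_1 by simp
next
  case (ge2 n)
  have "{w. admissible (Suc (Suc n)) w} \<subseteq>
      (\<lambda>u. 2 * u) ` {u. admissible (Suc n) u} \<union> (\<lambda>u. 2 * u + 1) ` {u. admissible n u}"
  proof
    fix w assume w: "w \<in> {w. admissible (Suc (Suc n)) w}"
    show "w \<in> (\<lambda>u. 2 * u) ` {u. admissible (Suc n) u} \<union> (\<lambda>u. 2 * u + 1) ` {u. admissible n u}"
    proof (cases "even w")
      case True
      then obtain u where "w = 2 * u" by blast
      with w show ?thesis using admissible_double by blast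
    next
      case False
      then obtain u where "w = 2 * u + 1" using oddE by blast
      with w show ?thesis using admissible_double_Suc by blast
    qed
  qed
  then have "card {w. admissible (Suc (Suc n)) w} \<le>
      card ((\<lambda>u. 2 * u) ` {u. admissible (Suc n) u} \<union> (\<lambda>u. 2 * u + 1) ` {u. admissible n u})"
    by (rule card_mono[rotated]) (simp add: finite_admissible)
  also have "\<dots> \<le> card ((\<lambda>u. 2 * u) ` {u. admissible (Suc n) u}) +
      card ((\<lambda>u. 2 * u + 1) ` {u. admissible n u})"
    by (rule card_Un_le)
  also have "\<dots> \<le> card {u. admissible (Suc n) u} + card {u. admissible n u}"
    by (intro add_mono card_image_le finite_admissible)
  finally have "real (card {w. admissible (Suc (Suc n)) w}) \<le>
      golden_ratio ^ Suc n + golden_ratio ^ n"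
    using ge2 by linarith
  also have "\<dots> = golden_ratio ^ n * golden_ratio ^ 2"
    by (simp add: golden_ratio_square algebra_simps)
  finally show ?case by (simp add: power2_eq_square mult_ac)
qed

section \<open>Column-by-column evaluation of shift sums on masks\<close>

text \<open>Tabulates \<open>shift_sum\<close> with the bits below \<open>b\<close> still to be shifted. Moving a bit onto an occupied
  position gives a minor with two equal columns, so only moves to free positions contribute.\<close>

fun shift_table :: "nat \<Rightarrow> (nat \<Rightarrow> real) \<Rightarrow> nat \<Rightarrow> nat \<Rightarrow> nat \<Rightarrow> real" where
  "shift_table n y 0 r w = (if r = 0 \<and> admissible n w then y w else 0)"
| "shift_table n y (Suc b) r w = shift_table n y b r w +
     (if admissible n w \<and> bit w b \<and> \<not> bit w (Suc b) \<and> 0 < r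
      then shift_table n y b (r - 1) (w + 2 ^ b) else 0)"

text \<open>The table holds 0 at inadmissible masks, so what it evaluates exactly is the shift sum
  of f cut off outside the admissible column range.\<close>

definition restrict_columns :: "nat \<Rightarrow> (nat list \<Rightarrow> real) \<Rightarrow> nat list \<Rightarrow> real" where
  "restrict_columns n f cs = (if \<forall>c\<in>set cs. c < n - length cs then f cs else 0)"

lemma shift_sum_not_distinct:
  assumes "\<And>cs. \<not> distinct cs \<Longrightarrow> f cs = 0" "\<not> distinct C"
  shows "shift_sum f A C r = (0::real)"
  using assms(2) by (induction A arbitrary: C r) (auto simp: assms(1))

text \<open>Entries of C are never removed and the total length of A and C is invariant, so an
  out-of-range column stays out of range in every leaf of the recursion.\<close>

lemma shift_sum_restrict_columns_0:
  assumes "c \<in> set C" "n - (length A + length C) \<le> c"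
  shows "shift_sum (restrict_columns n f) A C r = 0"
  using assms by (induction A arbitrary: C r) (auto simp: restrict_columns_def)

lemma shift_sum_restrict_columns_0':
  assumes "c \<in> set A" "n - (length A + length C) \<le> c"
  shows "shift_sum (restrict_columns n f) A C r = 0"
  using assms
proof (induction A arbitrary: C r)
  case (Cons x A)
  show ?case
  proof (cases "c \<in> set A")
    case True
    then show ?thesis using Cons by auto
  next
    case False
    then have "x = c" using Cons.prems by simp
    then show ?thesis
      using Cons.prems shift_sum_restrict_columns_0[of c "c # C" n A]
        shift_sum_restrict_columns_0[of "Suc c" "Suc c # C" n A] by simp
  qed
qed simp

text \<open>If every undecided column has room for one shift, no reachable configuration is cut
  off.\<close>

lemma shift_sum_restrict_columns:
  assumes "\<forall>x\<in>set A. Suc x < n - (length A + length C)" "\<forall>x\<in>set C. x < n - (length A + length C)"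
  shows "shift_sum (restrict_columns n f) A C r = shift_sum f A C r"
  using assms by (induction A arbitrary: C r) (auto simp: restrict_columns_def)

lemma columns_split:
  assumes "b < n"
  shows "columns n w = columns b w @ filter (bit w) [b..<n]"
    and "filter (bit w) [b..<n] = (if bit w b then [b] else []) @ filter (bit w) [Suc b..<n]"
  using assms upt_add_eq_append[of 0 b "n - b"] by (auto simp: columns_def upt_conv_Cons)

text \<open>At level b the mask encodes both lists of \<open>shift_sum\<close>: bits below b are
  undecided, bits from b on are final. The step at Suc b decides column b, which either stays or
  moves, the mask becoming w + 2^b. It remains to see that the moves omitted by the table contribute
  0.\<close>

lemma shift_table_eq_shift_sum:
  assumes f: "\<And>cs. \<not> distinct cs \<Longrightarrow> f cs = 0"
    and y: "\<And>w. admissible n w \<Longrightarrow> y w = f (columns n w)"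
    and "b \<le> n" "w < 2 ^ n"
  shows "shift_table n y b r w =
    shift_sum (restrict_columns n f) (rev (columns b w)) (filter (bit w) [b..<n]) r"
  using assms(3,4)
proof (induction b arbitrary: r w)
  case 0
  have "filter (bit w) [0..<n] = columns n w" by (simp add: columns_def)
  moreover have "columns 0 w = []" by (simp add: columns_def)
  ultimately show ?case
    using 0 y[of w] by (simp add: restrict_columns_def admissible_columns)
next
  case (Suc b)
  let ?f = "restrict_columns n f"
  have b: "b < n" using Suc.prems by simp
  have len: "length (columns b w) + length (filter (bit w) [b..<n]) = length (columns n w)"
    using columns_split(1)[OF b, of w] by simp
  have restrict: "\<not> distinct cs \<Longrightarrow> ?f cs = 0" for cs by (simp add: restrict_columns_def f)
  show ?case
  proof (cases "bit w b")
    case False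
    then have "columns (Suc b) w = columns b w" by (simp add: columns_def)
    with False show ?thesis using Suc b columns_split(2)[OF b, of w] by simp
  next
    case True
    let ?C = "filter (bit w) [Suc b..<n]"
    have cols: "rev (columns (Suc b) w) = b # rev (columns b w)"
      using True by (simp add: columns_def)
    have low: "shift_table n y b r w = shift_sum ?f (rev (columns b w)) (b # ?C) r" for r
      using Suc.IH[of w r] Suc.prems True columns_split(2)[OF b, of w] by simp
    have high: "shift_sum ?f (rev (columns b w)) (Suc b # ?C) r =
        (if admissible n w \<and> \<not> bit w (Suc b) then shift_table n y b r (w + 2 ^ b) else 0)" for r
    proof -
      consider (not) "\<not> admissible n w" | (dup) "admissible n w" "bit w (Suc b)" |
        (shift) "admissible n w" "\<not> bit w (Suc b)" by blast
      then show ?thesis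
      proof cases
        \<comment> \<open>Shifts only increase columns and keep their number, so an out-of-range
          column of w, wherever it stands relative to b, makes the whole sum vanish.\<close>
        case not
        then obtain c where c: "c \<in> set (columns n w)" "n - length (columns n w) \<le> c"
          using admissible_columns[OF Suc.prems(2)] by (auto simp: not_less)
        consider "c \<in> set (columns b w)" | "c = b" | "c \<in> set ?C"
          using c(1) True unfolding columns_split(1)[OF b, of w] columns_split(2)[OF b, of w]
          by auto
        then have "shift_sum ?f (rev (columns b w)) (Suc b # ?C) r = 0"
        proof cases
          case 1
          then show ?thesis
            by (intro shift_sum_restrict_columns_0'[of c])
               (use c len True columns_split(2)[OF b, of w] in auto)
        next
          case 2
          then show ?thesis
            by (intro shift_sum_restrict_columns_0[of "Suc b"])
               (use c len True columns_split(2)[OF b, of w] in auto)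
        next
          case 3
          then show ?thesis
            by (intro shift_sum_restrict_columns_0[of c])
               (use c len True columns_split(2)[OF b, of w] in auto)
        qed
        with not show ?thesis by simp
      next
        \<comment> \<open>Columns are decided from the highest down, so Suc b is already final and
          the collision is permanent.\<close>
        case dup
        then have "Suc b < n" using Suc.prems(2) by (auto simp: less_power_iff_bits)
        then have "\<not> distinct (Suc b # ?C)" using dup by simp
        then have "shift_sum ?f (rev (columns b w)) (Suc b # ?C) r = 0"
          by (rule shift_sum_not_distinct[rotated]) (rule restrict)
        with dup show ?thesis by simp
      next
        case shift
        have "0 < popcount w"
          using length_columns[OF Suc.prems(2)] len True columns_split(2)[OF b, of w] by auto
        moreover have "b < n - popcount w"
          using shift(1) True by (auto simp: admissible_def less_power_iff_bits)
        ultimately have Sb: "Suc b < n" by simp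
        have bits: "bit (w + 2 ^ b) c \<longleftrightarrow> c = Suc b \<or> (c \<noteq> b \<and> bit w c)" for c
          unfolding plus_power_eq_set_bit[OF True shift(2)]
          by (auto simp: bit_set_bit_iff bit_unset_bit_iff)
        have "w + 2 ^ b < 2 ^ n"
          using Suc.prems(2) Sb unfolding less_power_iff_bits bits by auto
        then have "shift_table n y b r (w + 2 ^ b) =
            shift_sum ?f (rev (columns b (w + 2 ^ b))) (filter (bit (w + 2 ^ b)) [b..<n]) r"
          using Suc.IH b by simp
        also have "columns b (w + 2 ^ b) = columns b w"
          unfolding columns_def by (rule filter_cong) (auto simp: bits)
        also have "filter (bit (w + 2 ^ b)) [b..<n] = Suc b # filter (bit w) [Suc (Suc b)..<n]"
        proof -
          have "filter (bit (w + 2 ^ b)) [Suc (Suc b)..<n] = filter (bit w) [Suc (Suc b)..<n]"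
            by (rule filter_cong) (auto simp: bits)
          then show ?thesis
            using Sb b by (simp add: upt_conv_Cons bits)
        qed
        also have "filter (bit w) [Suc (Suc b)..<n] = ?C"
          using shift Sb by (simp add: upt_conv_Cons)
        finally show ?thesis using shift by simp
      qed
    qed
    have "shift_table n y (Suc b) r w = shift_sum ?f (rev (columns b w)) (b # ?C) r +
        (if r = 0 then 0 else shift_sum ?f (rev (columns b w)) (Suc b # ?C) (r - 1))"
      unfolding shift_table.simps low high using True by auto
    then show ?thesis unfolding cols by simp
  qed
qed

text \<open>Turns a sum over positions in the column list into a loop over all bits, the position
  being the number of hits below b.\<close>

lemma sum_filter_upt:
  fixes F :: "nat \<Rightarrow> nat \<Rightarrow> real"
  shows "(\<Sum>q<length (filter P [0..<n]). F q (filter P [0..<n] ! q)) =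
    (\<Sum>b<n. if P b then F (length (filter P [0..<b])) b else 0)"
proof (induction n)
  case (Suc n)
  show ?case
  proof (cases "P n")
    case True
    have "(\<Sum>q<length (filter P [0..<n]). F q ((filter P [0..<n] @ [n]) ! q)) =
      (\<Sum>q<length (filter P [0..<n]). F q (filter P [0..<n] ! q))"
      by (rule sum.cong) (auto simp: nth_append)
    with True Suc show ?thesis by (simp add: nth_append)
  qed (use Suc in simp)
qed simp

text \<open>\<open>partial_hankel_minor\<close> rewritten on masks, in the form in which the program
  evaluates it: y is the table row of the other factor, l m the coefficient of the variable on
  antidiagonal m.\<close>

definition derivative_step :: "nat \<Rightarrow> (nat \<Rightarrow> real) \<Rightarrow> (nat \<Rightarrow> real) \<Rightarrow> nat \<Rightarrow> real" where
  "derivative_step n l y w = (\<Sum>b<n. if bit w b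
     then \<Sum>p<popcount w. (-1) ^ (p + popcount (w mod 2 ^ b)) * l (b + p) *
       shift_table n y n (popcount w - 1 - p) (w - 2 ^ b)
     else 0)"

lemma pairing_var_mult_hankel_minor:
  assumes a: "\<And>m. partial v (a m) = const (l m)"
    and y: "\<And>w. admissible n w \<Longrightarrow> y w = pairing h (hankel_minor a (columns n w))"
    and w: "admissible n w"
  shows "pairing (var v * h) (hankel_minor a (columns n w)) = derivative_step n l y w"
proof -
  define f where "f cs = pairing h (hankel_minor a cs)" for cs
  define cs where "cs = columns n w"
  define k where "k = popcount w"
  have wn: "w < 2 ^ n" using w by (rule admissible_less)
  have k: "length cs = k" by (simp add: cs_def k_def length_columns[OF wn])
  have f0: "f cs = 0" if "\<not> distinct cs" for cs
    using that by (simp add: f_def hankel_minor_not_distinct)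
  define F where "F q c = (\<Sum>p<k. (-1) ^ (q + p) * l (c + p) *
      shift_sum f (rev (take q cs @ drop (Suc q) cs)) [] (k - 1 - p))" for q c
  have "pairing (var v * h) (hankel_minor a cs) = (\<Sum>q<length cs. F q (cs ! q))"
    unfolding pairing_var_mult_left partial_hankel_minor[of v a l, OF a] F_def f_def
    by (simp only: pairing_sum pairing_const_mult pairing_shift_sum k)
  also have "\<dots> = (\<Sum>b<n. if bit w b then F (length (columns b w)) b else 0)"
    unfolding cs_def columns_def by (rule sum_filter_upt)
  also have "\<dots> = derivative_step n l y w"
    unfolding derivative_step_def
  proof (rule sum.cong)
    fix b assume "b \<in> {..<n}"
    then have b: "b < n" by simp
    show "(if bit w b then F (length (columns b w)) b else 0) =
      (if bit w b then \<Sum>p<popcount w. (-1) ^ (p + popcount (w mod 2 ^ b)) * l (b + p) *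
         shift_table n y n (popcount w - 1 - p) (w - 2 ^ b) else 0)"
    proof (cases "bit w b")
      case True
      let ?q = "length (columns b w)" and ?u = "w - 2 ^ b"
      have bits: "bit ?u c \<longleftrightarrow> c \<noteq> b \<and> bit w c" for c
        unfolding minus_power_eq_unset_bit[OF True] by (auto simp: bit_unset_bit_iff)
      have cs: "cs = columns b w @ b # filter (bit w) [Suc b..<n]"
        using columns_split[OF b, of w] True by (simp add: cs_def)
      have "columns b ?u = columns b w" "filter (bit ?u) [Suc b..<n] = filter (bit w) [Suc b..<n]"
        unfolding columns_def by (rule filter_cong; auto simp: bits)+
      then have cu: "take ?q cs @ drop (Suc ?q) cs = columns n ?u"
        using columns_split[OF b, of ?u] by (simp add: cs bits)
      have un: "?u < 2 ^ n" using wn by simp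
      have len: "length (columns n ?u) = k - 1" "0 < k"
        using k arg_cong[OF cu, of length] by (auto simp: cs)
      have sub: "set (columns n ?u) \<subseteq> set (columns n w)"
        by (auto simp: columns_def bits)
      have "shift_table n y n r ?u = shift_sum f (rev (columns n ?u)) [] r" for r
      proof -
        have "shift_table n y n r ?u = shift_sum (restrict_columns n f) (rev (columns n ?u)) [] r"
          using shift_table_eq_shift_sum[of f n y n ?u r, OF f0] y un by (simp add: f_def)
        also have "\<dots> = shift_sum f (rev (columns n ?u)) [] r"
        proof (rule shift_sum_restrict_columns)
          \<comment> \<open>Closure of the family: w has k columns below n - k, while the mask
            without column b has k - 1 columns and may use positions below n - k + 1. Every column
            can therefore be shifted, and the truncation is invisible.\<close>
          have "x < n - k" if "x \<in> set (columns n ?u)" for x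
            using that admissible_columns[OF wn] w k sub by (auto simp: cs_def)
          then show "\<forall>x\<in>set (rev (columns n ?u)). Suc x < n - (length (rev (columns n ?u)) + length [])"
            using len by fastforce
        qed simp
        finally show ?thesis .
      qed
      then show ?thesis
        using True unfolding F_def cu popcount_mod k_def[symmetric]
        by (simp add: add.commute)
    qed simp
  qed simp
  finally show ?thesis by (simp add: cs_def)
qed


section \<open>Cost-bounded execution and table filling\<close>

text \<open>Total correctness with a cost bound. An upper bound composes where exact costs differ
  between branches; by determinism of \<open>run\<close> the asserted run is the only one.\<close>

definition runs_within :: "com \<Rightarrow> store \<Rightarrow> nat \<Rightarrow> (store \<Rightarrow> bool) \<Rightarrow> bool" where
  "runs_within c s K Q \<longleftrightarrow> (\<exists>N t. run c s N t \<and> N \<le> K \<and> Q t)"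

lemma runs_within_weaken: "runs_within c s K Q \<Longrightarrow> K \<le> K' \<Longrightarrow> (\<And>t. Q t \<Longrightarrow> Q' t) \<Longrightarrow> runs_within c s K' Q'"
  unfolding runs_within_def using order_trans by blast

lemma runs_within_Skip: "Q s \<Longrightarrow> runs_within Skip s K Q"
  unfolding runs_within_def using run_Skip by blast

lemma runs_within_NAssign:
  "Q (set_nat a (map (\<lambda>e. nval e s) es) (nval e s) s) \<Longrightarrow> runs_within (NAssign a es e) s K Q"
  unfolding runs_within_def using run_NAssign by blast

lemma runs_within_RAssign:
  "num_ops e \<le> K \<Longrightarrow> Q (set_real a (map (\<lambda>e. nval e s) es) (rval e s) s) \<Longrightarrow>
   runs_within (RAssign a es e) s K Q"
  unfolding runs_within_def using run_RAssign by blast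

lemma runs_within_Seq: "runs_within c1 s K1 (\<lambda>t. runs_within c2 t K2 Q) \<Longrightarrow> runs_within (Seq c1 c2) s (K1 + K2) Q"
  unfolding runs_within_def by (meson add_mono run_Seq)

lemma runs_within_If:
  "(bval b s \<Longrightarrow> runs_within c1 s K Q) \<Longrightarrow> (\<not> bval b s \<Longrightarrow> runs_within c2 s K Q) \<Longrightarrow> runs_within (If b c1 c2) s K Q"
  unfolding runs_within_def by (meson run_IfTrue run_IfFalse)

lemma runs_within_While:
  assumes step: "\<And>i t. i < n \<Longrightarrow> I i t \<Longrightarrow> bval b t \<and> runs_within c t (K i) (I (Suc i))"
    and exit: "\<And>t. I n t \<Longrightarrow> \<not> bval b t"
    and "i \<le> n" "I i s"
  shows "runs_within (While b c) s (\<Sum>j\<in>{i..<n}. K j) (I n)"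
  using assms(3,4)
proof (induction "n - i" arbitrary: i s)
  case 0
  then have "i = n" by simp
  with 0 show ?case unfolding runs_within_def using exit run_WhileFalse by fastforce
next
  case (Suc m)
  then have i: "i < n" by simp
  obtain N t where t: "bval b s" "run c s N t" "N \<le> K i" "I (Suc i) t"
    using step[OF i Suc.prems(2)] unfolding runs_within_def by blast
  have "m = n - Suc i" using Suc.hyps(2) by simp
  then obtain N' u where u: "run (While b c) t N' u" "N' \<le> (\<Sum>j\<in>{Suc i..<n}. K j)" "I n u"
    using Suc.hyps(1)[of "Suc i" t] i t(4) unfolding runs_within_def by auto
  have "N + N' \<le> (\<Sum>j\<in>{i..<n}. K j)"
    using t(3) u(2) by (simp add: sum.atLeast_Suc_lessThan[OF i])
  with run_WhileTrue[OF t(1,2) u(1)] u(3) show ?case unfolding runs_within_def by blast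
qed

definition for_loop :: "string \<Rightarrow> nexp \<Rightarrow> com \<Rightarrow> com" where
  "for_loop x e c = Seq (NAssign x [] (NConst 0))
     (While (Less (NGet x []) e) (Seq c (NAssign x [] (NAdd (NGet x []) (NConst 1)))))"

lemma runs_within_for_loop:
  assumes init: "I 0 (set_nat x [] 0 s)"
    and bound: "\<And>i t. I i t \<Longrightarrow> nats t x [] = i \<and> nval e t = n"
    and step: "\<And>i t. i < n \<Longrightarrow> I i t \<Longrightarrow>
      runs_within c t (K i) (\<lambda>t'. nats t' x [] = i \<and> I (Suc i) (set_nat x [] (Suc i) t'))"
  shows "runs_within (for_loop x e c) s (\<Sum>i<n. K i) (I n)"
proof -
  have "runs_within (While (Less (NGet x []) e) (Seq c (NAssign x [] (NAdd (NGet x []) (NConst 1)))))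
      (set_nat x [] 0 s) (\<Sum>i\<in>{0..<n}. K i) (I n)"
  proof (rule runs_within_While[where I = I])
    fix i t assume i: "i < n" "I i t"
    have "runs_within (Seq c (NAssign x [] (NAdd (NGet x []) (NConst 1)))) t (K i + 0) (I (Suc i))"
      by (rule runs_within_Seq, rule runs_within_weaken[OF step[OF i] order_refl], rule runs_within_NAssign) auto
    with i bound[OF i(2)] show "bval (Less (NGet x []) e) t \<and>
        runs_within (Seq c (NAssign x [] (NAdd (NGet x []) (NConst 1)))) t (K i) (I (Suc i))"
      by simp
  qed (use bound init in auto)
  then have "runs_within (for_loop x e c) s (0 + (\<Sum>i\<in>{0..<n}. K i)) (I n)"
    unfolding for_loop_def by (intro runs_within_Seq runs_within_NAssign) simp
  then show ?thesis by (simp add: atLeast0LessThan)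
qed

text \<open>Frame condition for natural number arrays only. Real arrays are instead described
  through explicit expressions such as \<open>overwrite\<close>.\<close>

definition agree :: "string set \<Rightarrow> store \<Rightarrow> store \<Rightarrow> bool" where
  "agree V s t \<longleftrightarrow> (\<forall>a. a \<notin> V \<longrightarrow> nats t a = nats s a)"

lemma agree_refl [simp]: "agree V s s"
  by (simp add: agree_def)

lemma agreeD: "agree V s t \<Longrightarrow> a \<notin> V \<Longrightarrow> nats t a = nats s a"
  by (simp add: agree_def)

lemma agree_trans: "agree V s t \<Longrightarrow> agree W t u \<Longrightarrow> V \<subseteq> V' \<Longrightarrow> W \<subseteq> V' \<Longrightarrow> agree V' s u"
  unfolding agree_def by (metis subsetD)

lemma nats_set_nat [simp]: "nats (set_nat a ks k s) = (nats s)(a := (nats s a)(ks := k))"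
  and reals_set_nat [simp]: "reals (set_nat a ks k s) = reals s"
  and nats_set_real [simp]: "nats (set_real a ks x s) = nats s"
  and reals_set_real [simp]: "reals (set_real a ks x s) = (reals s)(a := (reals s a)(ks := x))"
  by (simp_all add: set_nat_def set_real_def)

lemma agree_set_real [simp]: "agree V s (set_real a ks x t) = agree V s t"
  by (simp add: agree_def)

lemma runs_within_for_loop_reals:
  assumes V: "insert x W \<subseteq> V" "x \<notin> W"
    and bound: "\<And>t. agree V s t \<Longrightarrow> nval e t = n"
    and start: "reals s = R 0"
    and step: "\<And>i t. i < n \<Longrightarrow> agree V s t \<Longrightarrow> nats t x [] = i \<Longrightarrow> reals t = R i \<Longrightarrow>
      runs_within c t (K i) (\<lambda>t'. agree W t t' \<and> reals t' = R (Suc i))"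
    and K: "(\<Sum>i<n. K i) \<le> K'"
  shows "runs_within (for_loop x e c) s K' (\<lambda>t. agree V s t \<and> reals t = R n)"
proof -
  define I where "I i t \<longleftrightarrow> nats t x [] = i \<and> agree V s t \<and> reals t = R i" for i t
  have "runs_within (for_loop x e c) s (\<Sum>i<n. K i) (I n)"
  proof (rule runs_within_for_loop)
    show "I 0 (set_nat x [] 0 s)" using V start by (auto simp: I_def agree_def)
  next
    fix i t assume "I i t"
    then show "nats t x [] = i \<and> nval e t = n" using bound by (auto simp: I_def)
  next
    fix i t assume i: "i < n" "I i t"
    show "runs_within c t (K i) (\<lambda>t'. nats t' x [] = i \<and> I (Suc i) (set_nat x [] (Suc i) t'))"
      by (rule runs_within_weaken[OF step[OF i(1)] order_refl])
         (use i V in \<open>auto simp: I_def agree_def\<close>)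
  qed
  then show ?thesis by (rule runs_within_weaken[OF _ K]) (simp add: I_def)
qed

text \<open>One function F describes the final contents of all cells a loop writes, so that
  iterations compose by taking unions of index sets.\<close>

definition overwrite :: "string \<Rightarrow> nat list set \<Rightarrow> (nat list \<Rightarrow> real) \<Rightarrow>
    (string \<Rightarrow> nat list \<Rightarrow> real) \<Rightarrow> string \<Rightarrow> nat list \<Rightarrow> real" where
  "overwrite a S F R = R(a := \<lambda>ks. if ks \<in> S then F ks else R a ks)"

lemma overwrite_empty [simp]: "overwrite a {} F R = R"
  by (simp add: overwrite_def)

lemma overwrite_overwrite: "overwrite a T F (overwrite a S F R) = overwrite a (S \<union> T) F R"
  by (auto simp: overwrite_def fun_eq_iff)

lemma overwrite_same: "overwrite a S F R a ks = (if ks \<in> S then F ks else R a ks)"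
  by (simp add: overwrite_def)

lemma overwrite_other: "b \<noteq> a \<Longrightarrow> overwrite a S F R b = R b"
  by (simp add: overwrite_def)

lemma update_eq_overwrite: "x = F ks \<Longrightarrow> R(a := (R a)(ks := x)) = overwrite a {ks} F R"
  by (auto simp: overwrite_def fun_eq_iff)

lemma runs_within_for_loop_overwrite:
  assumes V: "insert x W \<subseteq> V" "x \<notin> W"
    and bound: "\<And>t. agree V s t \<Longrightarrow> nval e t = n"
    and step: "\<And>i t. i < n \<Longrightarrow> agree V s t \<Longrightarrow> nats t x [] = i \<Longrightarrow>
      reals t = overwrite a (\<Union>j<i. T j) F (reals s) \<Longrightarrow>
      runs_within c t (K i) (\<lambda>t'. agree W t t' \<and> reals t' = overwrite a (T i) F (reals t))"
    and K: "(\<Sum>i<n. K i) \<le> K'"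
  shows "runs_within (for_loop x e c) s K' (\<lambda>t. agree V s t \<and> reals t = overwrite a (\<Union>j<n. T j) F (reals s))"
proof (rule runs_within_for_loop_reals[where R = "\<lambda>i. overwrite a (\<Union>j<i. T j) F (reals s)", OF V bound _ _ K])
  fix i t assume i: "i < n" "agree V s t" "nats t x [] = i" "reals t = overwrite a (\<Union>j<i. T j) F (reals s)"
  show "runs_within c t (K i) (\<lambda>t'. agree W t t' \<and> reals t' = overwrite a (\<Union>j<Suc i. T j) F (reals s))"
    by (rule runs_within_weaken[OF step[OF i] order_refl])
       (simp add: i(4) overwrite_overwrite lessThan_Suc Un_commute)
qed auto

section \<open>Loops over masks and their cost\<close>

abbreviation var_d where "var_d \<equiv> NGet ''d'' []"
abbreviation var_g where "var_g \<equiv> NGet ''g'' []"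
abbreviation var_e where "var_e \<equiv> NGet ''e'' []"
abbreviation var_u where "var_u \<equiv> NGet ''u'' []"
abbreviation var_w where "var_w \<equiv> NGet ''w'' []"
abbreviation var_b where "var_b \<equiv> NGet ''b'' []"
abbreviation var_r where "var_r \<equiv> NGet ''r'' []"
abbreviation var_i where "var_i \<equiv> NGet ''i'' []"
abbreviation pow2 where "pow2 e \<equiv> NGet ''p'' [e]"
abbreviation width where "width \<equiv> NAdd var_d var_d"

definition masks_ready :: "nat \<Rightarrow> store \<Rightarrow> bool" where
  "masks_ready d s \<longleftrightarrow> nats s ''d'' [] = d \<and> (\<forall>b\<le>2 * d. nats s ''p'' [b] = 2 ^ b) \<and>
     (\<forall>w<2 ^ (2 * d). nats s ''pc'' [w] = popcount w)"

lemma masks_ready_agree: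
  assumes "masks_ready d s" "agree V s t" "V \<subseteq> {''g'', ''e'', ''u'', ''w'', ''b'', ''r'', ''i''}"
  shows "masks_ready d t"
proof -
  have "{''d'', ''p'', ''pc''} \<inter> V = {}" using assms(3) by auto
  then have "nats t a = nats s a" if "a \<in> {''d'', ''p'', ''pc''}" for a
    using assms(2) that by (auto simp: agree_def)
  then show ?thesis using assms(1) by (simp add: masks_ready_def)
qed

definition admissible_test :: bexp where
  "admissible_test = Less var_w (pow2 (NSub width (NGet ''pc'' [var_w])))"

definition bit_test :: "nexp \<Rightarrow> bexp" where
  "bit_test e = Equal (NMod (NDiv var_w (pow2 e)) (NConst 2)) (NConst 1)"

lemma nval_width: "masks_ready d s \<Longrightarrow> nval width s = 2 * d"
  by (simp add: masks_ready_def)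

lemma bval_admissible_test:
  assumes "masks_ready d s" "nats s ''w'' [] = w" "w < 2 ^ (2 * d)"
  shows "bval admissible_test s \<longleftrightarrow> admissible (2 * d) w"
  using assms by (simp add: admissible_test_def admissible_def masks_ready_def mult_2)

lemma bval_bit_test:
  assumes "masks_ready d s" "nats s ''w'' [] = w" "nval e s \<le> 2 * d"
  shows "bval (bit_test e) s \<longleftrightarrow> bit w (nval e s)"
  using assms by (simp add: bit_test_def masks_ready_def bit_iff_odd odd_iff_mod_2_eq_one)

abbreviation num_admissible :: "nat \<Rightarrow> nat" where
  "num_admissible d \<equiv> card {w. admissible (2 * d) w}"

lemma sum_admissible:
  "(\<Sum>w<2 ^ (2 * d). if admissible (2 * d) w then c else 0) = num_admissible d * (c::nat)"
proof -
  have "{..<2 ^ (2 * d)} \<inter> {w. admissible (2 * d) w} = {w. admissible (2 * d) w}"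
    by (auto dest: admissible_less)
  then show ?thesis by (simp add: sum.If_cases)
qed

definition mask_row :: "nat \<Rightarrow> nat \<Rightarrow> nat list set" where
  "mask_row d g = {[g, w] | w. admissible (2 * d) w}"

lemma mask_row_eq_UN: "mask_row d g = (\<Union>w<2 ^ (2 * d). if admissible (2 * d) w then {[g, w]} else {})"
  by (auto simp: mask_row_def dest: admissible_less)

definition row_loop :: "com \<Rightarrow> com" where
  "row_loop c = for_loop ''w'' (pow2 width) (If admissible_test c Skip)"

text \<open>All 4^d masks are visited, but the cost K is charged only at admissible ones. The body
  may assume that outside row g of \<open>y\<close> the reals are still those of s, which makes
  reading the rows of other gates safe.\<close>

lemma runs_within_row_loop:
  assumes s: "masks_ready d s" and W: "W \<subseteq> {''b'', ''r'', ''i''}"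
    and step: "\<And>w t. admissible (2 * d) w \<Longrightarrow> masks_ready d t \<Longrightarrow> agree (insert ''w'' W) s t \<Longrightarrow>
      nats t ''w'' [] = w \<Longrightarrow> (\<forall>a. a \<noteq> ''y'' \<longrightarrow> reals t a = reals s a) \<Longrightarrow>
      (\<forall>ks. ks \<notin> mask_row d g \<longrightarrow> reals t ''y'' ks = reals s ''y'' ks) \<Longrightarrow>
      runs_within c t K (\<lambda>t'. agree W t t' \<and> reals t' = overwrite ''y'' {[g, w]} F (reals t))"
  shows "runs_within (row_loop c) s (num_admissible d * K)
    (\<lambda>t. agree (insert ''w'' W) s t \<and> reals t = overwrite ''y'' (mask_row d g) F (reals s))"
  unfolding row_loop_def mask_row_eq_UN
proof (rule runs_within_for_loop_overwrite[where K = "\<lambda>w. if admissible (2 * d) w then K else 0" and W = W])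
  have sub: "insert ''w'' W \<subseteq> {''g'', ''e'', ''u'', ''w'', ''b'', ''r'', ''i''}"
    by (rule subset_trans[OF insert_mono[OF W]]) simp
  note ready = masks_ready_agree[OF s _ sub]
  show "nval (pow2 width) t = 2 ^ (2 * d)" if "agree (insert ''w'' W) s t" for t
    using ready[OF that] by (simp add: nval_width masks_ready_def mult_2)
  fix w t assume w: "w < 2 ^ (2 * d)" "agree (insert ''w'' W) s t" "nats t ''w'' [] = w"
    and R: "reals t = overwrite ''y'' (\<Union>w<w. if admissible (2 * d) w then {[g, w]} else {}) F (reals s)"
  note test = bval_admissible_test[OF ready[OF w(2)] w(3,1)]
  show "runs_within (If admissible_test c Skip) t (if admissible (2 * d) w then K else 0)
    (\<lambda>t'. agree W t t' \<and> reals t' =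
      overwrite ''y'' (if admissible (2 * d) w then {[g, w]} else {}) F (reals t))"
  proof (rule runs_within_If)
    assume "bval admissible_test t"
    then have adm: "admissible (2 * d) w" using test by simp
    have "\<forall>a. a \<noteq> ''y'' \<longrightarrow> reals t a = reals s a" by (simp add: R overwrite_other)
    moreover have "\<forall>ks. ks \<notin> mask_row d g \<longrightarrow> reals t ''y'' ks = reals s ''y'' ks"
      by (auto simp: R overwrite_same mask_row_def split: if_splits)
    ultimately show "runs_within c t (if admissible (2 * d) w then K else 0) (\<lambda>t'. agree W t t' \<and>
        reals t' = overwrite ''y'' (if admissible (2 * d) w then {[g, w]} else {}) F (reals t))"
      using step[OF adm ready[OF w(2)] w(2,3)] adm by simp
  qed (use test in \<open>auto intro: runs_within_Skip\<close>)
qed (use W in \<open>auto simp: sum_admissible\<close>)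

definition plus_prog :: com where
  "plus_prog = row_loop (RAssign ''y'' [var_g, var_w]
     (RAdd (RGet ''y'' [NGet ''arg1'' [var_g], var_w]) (RGet ''y'' [NGet ''arg2'' [var_g], var_w])))"

lemma runs_within_plus_prog:
  assumes s: "masks_ready d s" and vals: "nats s ''g'' [] = g" "nats s ''arg1'' [g] = i" "nats s ''arg2'' [g] = j"
    and neq: "i \<noteq> g" "j \<noteq> g"
  shows "runs_within plus_prog s (num_admissible d) (\<lambda>t. agree {''w''} s t \<and>
    reals t = overwrite ''y'' (mask_row d g) (\<lambda>ks. reals s ''y'' [i, ks ! 1] + reals s ''y'' [j, ks ! 1]) (reals s))"
proof -
  have "runs_within plus_prog s (num_admissible d * 1) (\<lambda>t. agree (insert ''w'' {}) s t \<and>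
    reals t = overwrite ''y'' (mask_row d g) (\<lambda>ks. reals s ''y'' [i, ks ! 1] + reals s ''y'' [j, ks ! 1]) (reals s))"
    unfolding plus_prog_def
    by (rule runs_within_row_loop[OF s])
       (auto intro!: runs_within_RAssign update_eq_overwrite simp: agreeD vals neq mask_row_def)
  then show ?thesis by simp
qed

definition scale_prog :: com where
  "scale_prog = row_loop (RAssign ''y'' [var_g, var_w]
     (RMul (RGet ''scalar'' [var_e]) (RGet ''y'' [var_u, var_w])))"

lemma runs_within_scale_prog:
  assumes s: "masks_ready d s" and vals: "nats s ''g'' [] = g" "nats s ''e'' [] = e" "nats s ''u'' [] = u"
    and neq: "u \<noteq> g"
  shows "runs_within scale_prog s (num_admissible d) (\<lambda>t. agree {''w''} s t \<and>
    reals t = overwrite ''y'' (mask_row d g) (\<lambda>ks. reals s ''scalar'' [e] * reals s ''y'' [u, ks ! 1]) (reals s))"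
proof -
  have "runs_within scale_prog s (num_admissible d * 1) (\<lambda>t. agree (insert ''w'' {}) s t \<and>
    reals t = overwrite ''y'' (mask_row d g) (\<lambda>ks. reals s ''scalar'' [e] * reals s ''y'' [u, ks ! 1]) (reals s))"
    unfolding scale_prog_def
    by (rule runs_within_row_loop[OF s])
       (auto intro!: runs_within_RAssign update_eq_overwrite simp: agreeD vals neq mask_row_def)
  then show ?thesis by simp
qed

definition table_init :: com where
  "table_init = for_loop ''w'' (pow2 width) (for_loop ''r'' (NAdd var_d (NConst 1))
     (If (Conj (Equal var_r (NConst 0)) admissible_test)
        (RAssign ''Y'' [NConst 0, var_r, var_w] (RGet ''y'' [var_u, var_w]))
        (RAssign ''Y'' [NConst 0, var_r, var_w] (RConst 0))))"

text \<open>Copying a cell costs no ring operation; only a genuine shift of an admissible mask adds.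
  The scan of all masks thus costs at most one addition per admissible mask and value of r.\<close>

definition table_step :: com where
  "table_step = for_loop ''w'' (pow2 width) (for_loop ''r'' (NAdd var_d (NConst 1))
     (If (Conj admissible_test (Conj (bit_test var_b)
           (Conj (Neg (bit_test (NAdd var_b (NConst 1)))) (Less (NConst 0) var_r))))
        (RAssign ''Y'' [NAdd var_b (NConst 1), var_r, var_w]
           (RAdd (RGet ''Y'' [var_b, var_r, var_w])
                 (RGet ''Y'' [var_b, NSub var_r (NConst 1), NAdd var_w (pow2 var_b)])))
        (RAssign ''Y'' [NAdd var_b (NConst 1), var_r, var_w] (RGet ''Y'' [var_b, var_r, var_w]))))"

definition table_layer :: "nat \<Rightarrow> nat \<Rightarrow> nat list set" where
  "table_layer d b = (\<Union>w<2 ^ (2 * d). \<Union>r<Suc d. {[b, r, w]})"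

definition table_entry :: "nat \<Rightarrow> (nat \<Rightarrow> real) \<Rightarrow> nat list \<Rightarrow> real" where
  "table_entry d y ks = shift_table (2 * d) y (ks ! 0) (ks ! 1) (ks ! 2)"

lemma mem_table_layer: "[b', r, w] \<in> table_layer d b \<longleftrightarrow> b' = b \<and> r \<le> d \<and> w < 2 ^ (2 * d)"
  by (auto simp: table_layer_def less_Suc_eq_le)

lemma runs_within_table_init:
  assumes s: "masks_ready d s" and u: "nats s ''u'' [] = u"
  shows "runs_within table_init s 0 (\<lambda>t. agree {''w'', ''r''} s t \<and> reals t =
    overwrite ''Y'' (table_layer d 0) (table_entry d (\<lambda>w. reals s ''y'' [u, w])) (reals s))"
  unfolding table_init_def table_layer_def
proof (rule runs_within_for_loop_overwrite[where W = "{''r''}" and K = "\<lambda>_. 0"])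
  have ready: "masks_ready d t" if "agree {''w'', ''r''} s t" for t
    by (rule masks_ready_agree[OF s that]) simp
  show "nval (pow2 width) t = 2 ^ (2 * d)" if "agree {''w'', ''r''} s t" for t
    using ready[OF that] by (simp add: nval_width masks_ready_def mult_2)
  fix w t
  let ?F = "table_entry d (\<lambda>w. reals s ''y'' [u, w])"
  assume w: "w < 2 ^ (2 * d)" "agree {''w'', ''r''} s t" "nats t ''w'' [] = w"
    and R: "reals t = overwrite ''Y'' (\<Union>w<w. \<Union>r<Suc d. {[0, r, w]}) ?F (reals s)"
  show "runs_within (for_loop ''r'' (NAdd var_d (NConst 1)) (If (Conj (Equal var_r (NConst 0)) admissible_test)
        (RAssign ''Y'' [NConst 0, var_r, var_w] (RGet ''y'' [var_u, var_w]))
        (RAssign ''Y'' [NConst 0, var_r, var_w] (RConst 0)))) t 0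
    (\<lambda>t'. agree {''r''} t t' \<and> reals t' = overwrite ''Y'' (\<Union>r<Suc d. {[0, r, w]}) ?F (reals t))"
  proof (rule runs_within_for_loop_overwrite[where W = "{}" and K = "\<lambda>_. 0"])
    have ready': "masks_ready d t'" if "agree {''r''} t t'" for t'
      by (rule masks_ready_agree[OF ready[OF w(2)] that]) simp
    show "nval (NAdd var_d (NConst 1)) t' = Suc d" if "agree {''r''} t t'" for t'
      using ready'[OF that] by (simp add: masks_ready_def)
    fix r t'
    assume r: "r < Suc d" "agree {''r''} t t'" "nats t' ''r'' [] = r"
      and R': "reals t' = overwrite ''Y'' (\<Union>r<r. {[0, r, w]}) ?F (reals t)"
    have t'w: "nats t' ''w'' [] = w" "nats t' ''u'' [] = u"
      using w r u by (auto simp: agreeD)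
    have y: "reals t' ''y'' = reals s ''y''" by (simp add: R R' overwrite_other)
    note test = bval_admissible_test[OF ready'[OF r(2)] t'w(1) w(1)]
    show "runs_within (If (Conj (Equal var_r (NConst 0)) admissible_test)
        (RAssign ''Y'' [NConst 0, var_r, var_w] (RGet ''y'' [var_u, var_w]))
        (RAssign ''Y'' [NConst 0, var_r, var_w] (RConst 0))) t' 0
      (\<lambda>t''. agree {} t' t'' \<and> reals t'' = overwrite ''Y'' {[0, r, w]} ?F (reals t'))"
      by (auto intro!: runs_within_If runs_within_RAssign update_eq_overwrite simp: test t'w r(3) y table_entry_def)
  qed auto
qed auto

lemma runs_within_table_step:
  assumes s: "masks_ready d s" and b: "nats s ''b'' [] = b" "b < 2 * d"
    and layer: "\<And>r w. r \<le> d \<Longrightarrow> w < 2 ^ (2 * d) \<Longrightarrow>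
      reals s ''Y'' [b, r, w] = shift_table (2 * d) y b r w"
  shows "runs_within table_step s (num_admissible d * Suc d) (\<lambda>t. agree {''w'', ''r''} s t \<and> reals t =
    overwrite ''Y'' (table_layer d (Suc b)) (table_entry d y) (reals s))"
  unfolding table_step_def table_layer_def
proof (rule runs_within_for_loop_overwrite[where W = "{''r''}" and K = "\<lambda>w. if admissible (2 * d) w then Suc d else 0"])
  have ready: "masks_ready d t" if "agree {''w'', ''r''} s t" for t
    by (rule masks_ready_agree[OF s that]) simp
  show "nval (pow2 width) t = 2 ^ (2 * d)" if "agree {''w'', ''r''} s t" for t
    using ready[OF that] by (simp add: nval_width masks_ready_def mult_2)
  fix w t
  let ?F = "table_entry d y"
  assume w: "w < 2 ^ (2 * d)" "agree {''w'', ''r''} s t" "nats t ''w'' [] = w"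
    and R: "reals t = overwrite ''Y'' (\<Union>w<w. \<Union>r<Suc d. {[Suc b, r, w]}) ?F (reals s)"
  show "runs_within (for_loop ''r'' (NAdd var_d (NConst 1)) (If (Conj admissible_test (Conj (bit_test var_b)
           (Conj (Neg (bit_test (NAdd var_b (NConst 1)))) (Less (NConst 0) var_r))))
        (RAssign ''Y'' [NAdd var_b (NConst 1), var_r, var_w]
           (RAdd (RGet ''Y'' [var_b, var_r, var_w])
                 (RGet ''Y'' [var_b, NSub var_r (NConst 1), NAdd var_w (pow2 var_b)])))
        (RAssign ''Y'' [NAdd var_b (NConst 1), var_r, var_w] (RGet ''Y'' [var_b, var_r, var_w]))))
    t (if admissible (2 * d) w then Suc d else 0)
    (\<lambda>t'. agree {''r''} t t' \<and> reals t' = overwrite ''Y'' (\<Union>r<Suc d. {[Suc b, r, w]}) ?F (reals t))"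
  proof (rule runs_within_for_loop_overwrite[where W = "{}" and K = "\<lambda>_. if admissible (2 * d) w then 1 else 0"])
    have ready': "masks_ready d t'" if "agree {''r''} t t'" for t'
      by (rule masks_ready_agree[OF ready[OF w(2)] that]) simp
    show "nval (NAdd var_d (NConst 1)) t' = Suc d" if "agree {''r''} t t'" for t'
      using ready'[OF that] by (simp add: masks_ready_def)
    fix r t'
    assume r: "r < Suc d" "agree {''r''} t t'" "nats t' ''r'' [] = r"
      and R': "reals t' = overwrite ''Y'' (\<Union>r<r. {[Suc b, r, w]}) ?F (reals t)"
    have t'w: "nats t' ''w'' [] = w" "nats t' ''b'' [] = b"
      using w r b by (auto simp: agreeD)
    have Y: "reals t' ''Y'' [b, r', w'] = shift_table (2 * d) y b r' w'"
      if "r' \<le> d" "w' < 2 ^ (2 * d)" for r' w'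
      using layer[OF that] by (auto simp: R R' overwrite_same)
    have p: "nats t' ''p'' [b] = 2 ^ b"
      using ready'[OF r(2)] b(2) by (simp add: masks_ready_def)
    \<comment> \<open>The shifted mask is read from the previous layer and must lie in the tabulated
      range: a set bit b of an admissible mask forces Suc b < 2 * d.\<close>
    have shift: "w + 2 ^ b < 2 ^ (2 * d)" if "admissible (2 * d) w" "bit w b" "\<not> bit w (Suc b)"
    proof -
      have "b < 2 * d - popcount w"
        using that by (auto simp: admissible_def less_power_iff_bits)
      moreover have "0 < popcount w"
        unfolding length_columns[OF w(1), symmetric]
        by (rule length_pos_if_in_set[of b]) (use that(2) b(2) in \<open>simp add: columns_def\<close>)
      ultimately have "Suc b < 2 * d" by simp
      with w(1) show ?thesis
        unfolding plus_power_eq_set_bit[OF that(2,3)] less_power_iff_bits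
        by (auto simp: bit_set_bit_iff bit_unset_bit_iff)
    qed
    note tests = bval_admissible_test[OF ready'[OF r(2)] t'w(1) w(1)]
      bval_bit_test[OF ready'[OF r(2)] t'w(1)]
    show "runs_within (If (Conj admissible_test (Conj (bit_test var_b)
           (Conj (Neg (bit_test (NAdd var_b (NConst 1)))) (Less (NConst 0) var_r))))
        (RAssign ''Y'' [NAdd var_b (NConst 1), var_r, var_w]
           (RAdd (RGet ''Y'' [var_b, var_r, var_w])
                 (RGet ''Y'' [var_b, NSub var_r (NConst 1), NAdd var_w (pow2 var_b)])))
        (RAssign ''Y'' [NAdd var_b (NConst 1), var_r, var_w] (RGet ''Y'' [var_b, var_r, var_w])))
      t' (if admissible (2 * d) w then 1 else 0)
      (\<lambda>t''. agree {} t' t'' \<and> reals t'' = overwrite ''Y'' {[Suc b, r, w]} ?F (reals t'))"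
      by (rule runs_within_If; rule runs_within_RAssign)
         (use b r w(1) in \<open>auto intro!: update_eq_overwrite simp: tests t'w r(3) Y shift p table_entry_def\<close>)
  qed auto
qed (auto simp: sum_admissible)

definition table_prog :: com where
  "table_prog = Seq table_init (for_loop ''b'' width table_step)"

lemma runs_within_table_prog:
  assumes s: "masks_ready d s" and u: "nats s ''u'' [] = u"
  shows "runs_within table_prog s (num_admissible d * (2 * d * Suc d)) (\<lambda>t. agree {''w'', ''r'', ''b''} s t \<and> reals t =
    overwrite ''Y'' (\<Union>b<Suc (2 * d). table_layer d b) (table_entry d (\<lambda>w. reals s ''y'' [u, w])) (reals s))"
proof -
  let ?F = "table_entry d (\<lambda>w. reals s ''y'' [u, w])"
  have "runs_within table_prog s (0 + num_admissible d * (2 * d * Suc d)) (\<lambda>t. agree {''w'', ''r'', ''b''} s t \<and> reals t =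
    overwrite ''Y'' (\<Union>b<Suc (2 * d). table_layer d b) ?F (reals s))"
    unfolding table_prog_def
  proof (rule runs_within_Seq, rule runs_within_weaken[OF runs_within_table_init[OF assms] order_refl])
    fix t1 assume t1: "agree {''w'', ''r''} s t1 \<and> reals t1 = overwrite ''Y'' (table_layer d 0) ?F (reals s)"
    have "runs_within (for_loop ''b'' width table_step) t1 (num_admissible d * (2 * d * Suc d))
      (\<lambda>t. agree {''w'', ''r'', ''b''} t1 t \<and> reals t =
        overwrite ''Y'' (\<Union>b<Suc (2 * d). table_layer d b) ?F (reals s))"
    proof (rule runs_within_for_loop_reals[where W = "{''w'', ''r''}" and K = "\<lambda>_. num_admissible d * Suc d" and
          R = "\<lambda>i. overwrite ''Y'' (\<Union>b<Suc i. table_layer d b) ?F (reals s)"])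
      have ready: "masks_ready d t" if "agree {''w'', ''r'', ''b''} t1 t" for t
        by (rule masks_ready_agree[OF masks_ready_agree[OF s conjunct1[OF t1]] that]) simp_all
      show "nval width t = 2 * d" if "agree {''w'', ''r'', ''b''} t1 t" for t
        using ready[OF that] by (rule nval_width)
      show "reals t1 = overwrite ''Y'' (\<Union>b<Suc 0. table_layer d b) ?F (reals s)"
        using t1 by (simp add: lessThan_Suc)
      fix b t
      assume t: "b < 2 * d" "agree {''w'', ''r'', ''b''} t1 t" "nats t ''b'' [] = b"
        "reals t = overwrite ''Y'' (\<Union>b<Suc b. table_layer d b) ?F (reals s)"
      show "runs_within table_step t (num_admissible d * Suc d) (\<lambda>t'. agree {''w'', ''r''} t t' \<and>
          reals t' = overwrite ''Y'' (\<Union>b<Suc (Suc b). table_layer d b) ?F (reals s))"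
      proof (rule runs_within_weaken[OF runs_within_table_step[OF ready[OF t(2)] t(3,1)] order_refl])
        fix r w :: nat assume "r \<le> d" "w < 2 ^ (2 * d)"
        then have "[b, r, w] \<in> (\<Union>b<Suc b. table_layer d b)" by (auto simp: mem_table_layer)
        then show "reals t ''Y'' [b, r, w] = shift_table (2 * d) (\<lambda>w. reals s ''y'' [u, w]) b r w"
          unfolding t(4) overwrite_same by (simp add: table_entry_def)
      next
        fix t' assume t': "agree {''w'', ''r''} t t' \<and>
          reals t' = overwrite ''Y'' (table_layer d (Suc b)) ?F (reals t)"
        then show "agree {''w'', ''r''} t t' \<and>
          reals t' = overwrite ''Y'' (\<Union>b<Suc (Suc b). table_layer d b) ?F (reals s)"
          by (simp add: t(4) overwrite_overwrite lessThan_Suc[of "Suc b"] Un_commute)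
      qed
    qed (auto simp: algebra_simps)
    then show "runs_within (for_loop ''b'' width table_step) t1 (num_admissible d * (2 * d * Suc d))
      (\<lambda>t. agree {''w'', ''r'', ''b''} s t \<and> reals t =
        overwrite ''Y'' (\<Union>b<Suc (2 * d). table_layer d b) ?F (reals s))"
      by (rule runs_within_weaken[OF _ order_refl]) (use t1 in \<open>auto elim: agree_trans\<close>)
  qed
  then show ?thesis by simp
qed


section \<open>Multiplication by a variable as a program\<close>

text \<open>With truncated subtraction, \<open>j\<close> is 0 on the antidiagonals m < d, read from
  the first column, and m - (d - 1) afterwards, read from the last row. The sign costs nothing:
  parity selects addition or subtraction, so each summand takes two operations.\<close>

definition accumulate :: com where
  "accumulate =
     (let m = NAdd var_b var_i; j = NSub m (NSub var_d (NConst 1));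
          summand = RMul (RGet ''X'' [NSub m j, j, NGet ''arg1'' [var_e]])
            (RGet ''Y'' [width, NSub (NSub (NGet ''pc'' [var_w]) (NConst 1)) var_i,
               NSub var_w (pow2 var_b)])
      in If (Equal (NMod (NAdd var_i (NGet ''pc'' [NMod var_w (pow2 var_b)])) (NConst 2)) (NConst 0))
           (RAssign ''y'' [var_g, var_w] (RAdd (RGet ''y'' [var_g, var_w]) summand))
           (RAssign ''y'' [var_g, var_w] (RSub (RGet ''y'' [var_g, var_w]) summand)))"

definition derivative_entry :: com where
  "derivative_entry = Seq (RAssign ''y'' [var_g, var_w] (RConst 0))
     (for_loop ''b'' width (If (bit_test var_b) (for_loop ''i'' (NGet ''pc'' [var_w]) accumulate) Skip))"

definition derivative_prog :: com where
  "derivative_prog = Seq table_prog (row_loop derivative_entry)"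

text \<open>Distinct columns cannot outnumber the range below 2 d - popcount w in which they
  lie.\<close>

lemma admissible_popcount:
  assumes "admissible (2 * d) w"
  shows "popcount w \<le> d"
proof -
  have "popcount w = length (columns (2 * d - popcount w) w)"
    using assms by (simp add: admissible_def length_columns)
  also have "\<dots> \<le> 2 * d - popcount w"
    unfolding columns_def using length_filter_le[of "bit w" "[0..<2 * d - popcount w]"] by simp
  finally show ?thesis by simp
qed

lemma runs_within_derivative_entry:
  fixes y :: "nat \<Rightarrow> real"
  assumes s: "masks_ready d s" and vals: "nats s ''g'' [] = g" "nats s ''e'' [] = e" "nats s ''w'' [] = w"
    and w: "admissible (2 * d) w"
    and Y: "\<And>r w. r \<le> d \<Longrightarrow> w < 2 ^ (2 * d) \<Longrightarrow>
      reals s ''Y'' [2 * d, r, w] = shift_table (2 * d) y (2 * d) r w"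
    and X: "\<And>m. reals s ''X'' [m - (m - (d - 1)), m - (d - 1), nats s ''arg1'' [e]] = l m"
  shows "runs_within derivative_entry s (2 * d * (d * 2)) (\<lambda>t. agree {''b'', ''i''} s t \<and>
    reals t = overwrite ''y'' {[g, w]} (\<lambda>ks. derivative_step (2 * d) l y (ks ! 1)) (reals s))"
proof -
  \<comment> \<open>Throughout this computation the real store differs from that of s only in the
    accumulator cell, so its content describes the whole store.\<close>
  define cell where "cell x = (reals s)(''y'' := (reals s ''y'')([g, w] := x))" for x
  define summand where "summand b p = (-1) ^ (p + popcount (w mod 2 ^ b)) * l (b + p) *
      shift_table (2 * d) y (2 * d) (popcount w - 1 - p) (w - 2 ^ b)" for b p
  define S where "S i = (\<Sum>b<i. if bit w b then \<Sum>p<popcount w. summand b p else 0)" for i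
  have wn: "w < 2 ^ (2 * d)" using w by (rule admissible_less)
  have cell_y: "cell x ''y'' [g, w] = x" "(cell x)(''y'' := (cell x ''y'')([g, w] := z)) = cell z"
    "cell x ''X'' = reals s ''X''" "cell x ''Y'' = reals s ''Y''" for x z
    by (simp_all add: cell_def)
  have "runs_within derivative_entry s (0 + 2 * d * (d * 2))
      (\<lambda>t. agree {''b'', ''i''} s t \<and> reals t = cell (S (2 * d)))"
    unfolding derivative_entry_def
  proof (rule runs_within_Seq, rule runs_within_RAssign)
    let ?s = "set_real ''y'' (map (\<lambda>e. nval e s) [var_g, var_w]) (rval (RConst 0) s) s"
    have s': "agree V ?s t \<longleftrightarrow> agree V s t" "reals ?s = cell 0" for V t
      by (auto simp: agree_def cell_def vals)
    have "runs_within (for_loop ''b'' width (If (bit_test var_b) (for_loop ''i'' (NGet ''pc'' [var_w]) accumulate) Skip))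
        ?s (2 * d * (d * 2)) (\<lambda>t. agree {''b'', ''i''} ?s t \<and> reals t = cell (S (2 * d)))"
    proof (rule runs_within_for_loop_reals[where W = "{''i''}" and K = "\<lambda>_. d * 2" and R = "\<lambda>i. cell (S i)"])
      have ready: "masks_ready d t" if "agree {''b'', ''i''} ?s t" for t
        by (rule masks_ready_agree[OF s that[unfolded s']]) simp
      show "nval width t = 2 * d" if "agree {''b'', ''i''} ?s t" for t
        using ready[OF that] by (rule nval_width)
      show "reals ?s = cell (S 0)" unfolding s' by (simp add: S_def)
      fix b t assume t: "b < 2 * d" "agree {''b'', ''i''} ?s t" "nats t ''b'' [] = b" "reals t = cell (S b)"
      have tw: "nats t ''w'' [] = w" using t(2) vals unfolding s' by (simp add: agreeD)
      have test: "bval (bit_test var_b) t \<longleftrightarrow> bit w b"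
        using bval_bit_test[OF ready[OF t(2)] tw, of var_b] t by simp
      show "runs_within (If (bit_test var_b) (for_loop ''i'' (NGet ''pc'' [var_w]) accumulate) Skip) t (d * 2)
        (\<lambda>t'. agree {''i''} t t' \<and> reals t' = cell (S (Suc b)))"
      proof (rule runs_within_If)
        assume "bval (bit_test var_b) t"
        then have bit: "bit w b" using test by simp
        have "runs_within (for_loop ''i'' (NGet ''pc'' [var_w]) accumulate) t (d * 2)
          (\<lambda>t'. agree {''i''} t t' \<and> reals t' = cell (S b + (\<Sum>p<popcount w. summand b p)))"
        proof (rule runs_within_for_loop_reals[where W = "{}" and K = "\<lambda>_. 2" and
              R = "\<lambda>i. cell (S b + (\<Sum>p<i. summand b p))"])
          have ready': "masks_ready d t'" if "agree {''i''} t t'" for t'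
            by (rule masks_ready_agree[OF ready[OF t(2)] that]) simp
          show "nval (NGet ''pc'' [var_w]) t' = popcount w" if "agree {''i''} t t'" for t'
            using ready'[OF that] wn tw agreeD[OF that, of "''w''"] by (simp add: masks_ready_def)
          show "reals t = cell (S b + (\<Sum>p<0. summand b p))" by (simp add: t)
          fix p t' assume t': "p < popcount w" "agree {''i''} t t'" "nats t' ''i'' [] = p"
            "reals t' = cell (S b + (\<Sum>p<p. summand b p))"
          have v: "nats t' ''w'' [] = w" "nats t' ''b'' [] = b" "nats t' ''g'' [] = g" "nats t' ''e'' [] = e"
            "nats t' ''arg1'' = nats s ''arg1''"
            using t(2,3) t'(2) vals unfolding s' by (auto simp: agreeD)
          have pw: "w mod 2 ^ b < 2 ^ (2 * d)"
            using wn mod_less_eq_dividend[of w "2 ^ b"] by linarith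
          have tabs: "nats t' ''d'' [] = d" "nats t' ''p'' [b] = 2 ^ b" "nats t' ''pc'' [w] = popcount w"
            "nats t' ''pc'' [w mod 2 ^ b] = popcount (w mod 2 ^ b)"
            using ready'[OF t'(2)] t(1) wn pw by (auto simp: masks_ready_def)
          have Xt: "reals t' ''X'' [b + p - (b + p - (d - 1)), b + p - (d - 1), nats s ''arg1'' [e]] = l (b + p)"
            by (simp only: t' cell_y X)
          \<comment> \<open>The table covers only r up to d, which suffices because an admissible
            mask has at most d bits.\<close>
          have Yt: "reals t' ''Y'' [d + d, popcount w - Suc 0 - p, w - 2 ^ b] =
              shift_table (2 * d) y (2 * d) (popcount w - 1 - p) (w - 2 ^ b)"
            using Y[of "popcount w - 1 - p" "w - 2 ^ b"] admissible_popcount[OF w] wn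
            by (simp add: t' cell_y mult_2)
          have yt: "reals t' ''y'' [g, w] = S b + (\<Sum>p<p. summand b p)"
            by (simp add: t' cell_y)
          have upd: "(reals t')(''y'' := (reals t' ''y'')([g, w] := z)) = cell z" for z
            by (simp only: t' cell_y)
          have sign: "(p + popcount (w mod 2 ^ b)) mod 2 = 0 \<longleftrightarrow> even (p + popcount (w mod 2 ^ b))"
            by (simp add: even_iff_mod_2_eq_zero)
          show "runs_within accumulate t' 2 (\<lambda>t''. agree {} t' t'' \<and>
              reals t'' = cell (S b + (\<Sum>p<Suc p. summand b p)))"
            unfolding accumulate_def Let_def
          proof (rule runs_within_If)
            assume "bval (Equal (NMod (NAdd var_i (NGet ''pc'' [NMod var_w (pow2 var_b)])) (NConst 2)) (NConst 0)) t'"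
            then have "even (p + popcount (w mod 2 ^ b))" by (simp add: v tabs t'(3) sign)
            then have "l (b + p) *
                shift_table (2 * d) y (2 * d) (popcount w - 1 - p) (w - 2 ^ b) = summand b p"
              by (simp add: summand_def)
            then show "runs_within (RAssign ''y'' [var_g, var_w] (RAdd (RGet ''y'' [var_g, var_w])
                (RMul (RGet ''X'' [NSub (NAdd var_b var_i) (NSub (NAdd var_b var_i) (NSub var_d (NConst 1))),
                   NSub (NAdd var_b var_i) (NSub var_d (NConst 1)), NGet ''arg1'' [var_e]])
                 (RGet ''Y'' [width, NSub (NSub (NGet ''pc'' [var_w]) (NConst 1)) var_i,
                   NSub var_w (pow2 var_b)])))) t' 2
              (\<lambda>t''. agree {} t' t'' \<and> reals t'' = cell (S b + (\<Sum>p<Suc p. summand b p)))"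
              by (intro runs_within_RAssign) (use Xt Yt in \<open>simp_all add: v tabs t'(3) yt upd add.assoc\<close>)
          next
            assume "\<not> bval (Equal (NMod (NAdd var_i (NGet ''pc'' [NMod var_w (pow2 var_b)])) (NConst 2)) (NConst 0)) t'"
            then have "odd (p + popcount (w mod 2 ^ b))" by (simp add: v tabs t'(3) sign)
            then have "l (b + p) *
                shift_table (2 * d) y (2 * d) (popcount w - 1 - p) (w - 2 ^ b) = - summand b p"
              by (simp add: summand_def)
            then show "runs_within (RAssign ''y'' [var_g, var_w] (RSub (RGet ''y'' [var_g, var_w])
                (RMul (RGet ''X'' [NSub (NAdd var_b var_i) (NSub (NAdd var_b var_i) (NSub var_d (NConst 1))),
                   NSub (NAdd var_b var_i) (NSub var_d (NConst 1)), NGet ''arg1'' [var_e]])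
                 (RGet ''Y'' [width, NSub (NSub (NGet ''pc'' [var_w]) (NConst 1)) var_i,
                   NSub var_w (pow2 var_b)])))) t' 2
              (\<lambda>t''. agree {} t' t'' \<and> reals t'' = cell (S b + (\<Sum>p<Suc p. summand b p)))"
              by (intro runs_within_RAssign) (use Xt Yt in \<open>simp_all add: v tabs t'(3) yt upd add.assoc\<close>)
          qed
        qed (use admissible_popcount[OF w] in auto)
        then show "runs_within (for_loop ''i'' (NGet ''pc'' [var_w]) accumulate) t (d * 2)
          (\<lambda>t'. agree {''i''} t t' \<and> reals t' = cell (S (Suc b)))"
          using bit by (simp add: S_def)
      qed (use test t in \<open>auto intro!: runs_within_Skip simp: S_def\<close>)
    qed auto
    then show "runs_within (for_loop ''b'' width (If (bit_test var_b) (for_loop ''i'' (NGet ''pc'' [var_w]) accumulate) Skip))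
        ?s (2 * d * (d * 2)) (\<lambda>t. agree {''b'', ''i''} s t \<and> reals t = cell (S (2 * d)))"
      unfolding s' .
  qed simp
  moreover have "cell (S (2 * d)) = overwrite ''y'' {[g, w]} (\<lambda>ks. derivative_step (2 * d) l y (ks ! 1)) (reals s)"
    unfolding cell_def by (rule update_eq_overwrite) (simp add: S_def[unfolded summand_def] derivative_step_def)
  ultimately show ?thesis by simp
qed

lemma runs_within_derivative_prog:
  assumes s: "masks_ready d s"
    and vals: "nats s ''g'' [] = g" "nats s ''e'' [] = e" "nats s ''u'' [] = u"
    and X: "\<And>m. reals s ''X'' [m - (m - (d - 1)), m - (d - 1), nats s ''arg1'' [e]] = l m"
  shows "runs_within derivative_prog s (num_admissible d * (2 * d * Suc d) + num_admissible d * (2 * d * (d * 2)))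
    (\<lambda>t. agree {''w'', ''r'', ''b'', ''i''} s t \<and> (\<forall>a. a \<noteq> ''y'' \<longrightarrow> a \<noteq> ''Y'' \<longrightarrow> reals t a = reals s a) \<and>
      reals t ''y'' = overwrite ''y'' (mask_row d g)
        (\<lambda>ks. derivative_step (2 * d) l (\<lambda>w. reals s ''y'' [u, w]) (ks ! 1)) (reals s) ''y'')"
  unfolding derivative_prog_def
proof (rule runs_within_Seq, rule runs_within_weaken[OF runs_within_table_prog[OF s vals(3)] order_refl])
  let ?y = "\<lambda>w. reals s ''y'' [u, w]"
  let ?F = "\<lambda>ks. derivative_step (2 * d) l ?y (ks ! 1)"
  fix t1 assume t1: "agree {''w'', ''r'', ''b''} s t1 \<and> reals t1 =
    overwrite ''Y'' (\<Union>b<Suc (2 * d). table_layer d b) (table_entry d ?y) (reals s)"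
  have ready: "masks_ready d t1" by (rule masks_ready_agree[OF s conjunct1[OF t1]]) simp
  have vals1: "nats t1 ''g'' [] = g" "nats t1 ''e'' [] = e" "nats t1 ''arg1'' = nats s ''arg1''"
    using t1 vals by (auto simp: agreeD)
  have X1: "reals t1 ''X'' = reals s ''X''" "reals t1 ''y'' = reals s ''y''"
    using t1 by (simp_all add: overwrite_other)
  have Y1: "reals t1 ''Y'' [2 * d, r, w] = shift_table (2 * d) ?y (2 * d) r w"
    if "r \<le> d" "w < 2 ^ (2 * d)" for r w
  proof -
    have "[2 * d, r, w] \<in> (\<Union>b<Suc (2 * d). table_layer d b)"
      using that by (auto simp: mem_table_layer)
    then show ?thesis by (simp add: conjunct2[OF t1] overwrite_same table_entry_def)
  qed
  have "runs_within (row_loop derivative_entry) t1 (num_admissible d * (2 * d * (d * 2)))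
    (\<lambda>t. agree (insert ''w'' {''b'', ''i''}) t1 t \<and> reals t = overwrite ''y'' (mask_row d g) ?F (reals t1))"
  proof (rule runs_within_row_loop[OF ready])
    fix w t assume t: "admissible (2 * d) w" "masks_ready d t" "agree {''w'', ''b'', ''i''} t1 t"
      "nats t ''w'' [] = w" "\<forall>a. a \<noteq> ''y'' \<longrightarrow> reals t a = reals t1 a"
    show "runs_within derivative_entry t (2 * d * (d * 2))
        (\<lambda>t'. agree {''b'', ''i''} t t' \<and> reals t' = overwrite ''y'' {[g, w]} ?F (reals t))"
    proof (rule runs_within_derivative_entry[OF t(2) _ _ t(4,1)])
      show "nats t ''g'' [] = g" "nats t ''e'' [] = e" using vals1 t(3) by (auto simp: agreeD)
      show "reals t ''Y'' [2 * d, r, w] = shift_table (2 * d) ?y (2 * d) r w"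
        if "r \<le> d" "w < 2 ^ (2 * d)" for r w using Y1[OF that] t(5) by simp
      have "nats t ''arg1'' = nats s ''arg1''" using vals1 t(3) by (auto simp: agreeD)
      then show "reals t ''X'' [m - (m - (d - 1)), m - (d - 1), nats t ''arg1'' [e]] = l m" for m
        using X t(5) X1 by simp
    qed
  qed simp
  then show "runs_within (row_loop derivative_entry) t1 (num_admissible d * (2 * d * (d * 2)))
    (\<lambda>t. agree {''w'', ''r'', ''b'', ''i''} s t \<and> (\<forall>a. a \<noteq> ''y'' \<longrightarrow> a \<noteq> ''Y'' \<longrightarrow> reals t a = reals s a) \<and>
      reals t ''y'' = overwrite ''y'' (mask_row d g) ?F (reals s) ''y'')"
  proof (rule runs_within_weaken[OF _ order_refl])
    fix t assume t: "agree (insert ''w'' {''b'', ''i''}) t1 t \<and> reals t = overwrite ''y'' (mask_row d g) ?F (reals t1)"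
    then have "agree {''w'', ''r'', ''b'', ''i''} s t"
      by (intro agree_trans[OF conjunct1[OF t1] conjunct1]) auto
    moreover have "reals t a = reals s a" if "a \<noteq> ''y''" "a \<noteq> ''Y''" for a
      using t t1 that by (simp add: overwrite_other)
    moreover have "reals t ''y'' = overwrite ''y'' (mask_row d g) ?F (reals s) ''y''"
      using t X1 by (auto simp: overwrite_def)
    ultimately show "agree {''w'', ''r'', ''b'', ''i''} s t \<and>
      (\<forall>a. a \<noteq> ''y'' \<longrightarrow> a \<noteq> ''Y'' \<longrightarrow> reals t a = reals s a) \<and>
      reals t ''y'' = overwrite ''y'' (mask_row d g) ?F (reals s) ''y''" by blast
  qed
qed

definition pow_prog :: com where
  "pow_prog = Seq (NAssign ''p'' [NConst 0] (NConst 1))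
     (for_loop ''b'' width (NAssign ''p'' [NAdd var_b (NConst 1)] (NMul (NConst 2) (pow2 var_b))))"

definition popcount_prog :: com where
  "popcount_prog = for_loop ''w'' (pow2 width) (NAssign ''pc'' [var_w]
     (NAdd (NGet ''pc'' [NDiv var_w (NConst 2)]) (NMod var_w (NConst 2))))"

lemma runs_within_pow_prog:
  assumes d: "nats s ''d'' [] = d"
  shows "runs_within pow_prog s 0 (\<lambda>t. agree {''b'', ''p''} s t \<and> reals t = reals s \<and>
    (\<forall>b\<le>2 * d. nats t ''p'' [b] = 2 ^ b))"
proof -
  define I where "I i t \<longleftrightarrow> nats t ''b'' [] = i \<and> agree {''b'', ''p''} s t \<and> reals t = reals s \<and>
    (\<forall>b\<le>i. nats t ''p'' [b] = 2 ^ b)" for i t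
  have "runs_within pow_prog s (0 + (\<Sum>i<2 * d. 0)) (I (2 * d))"
    unfolding pow_prog_def
  proof (rule runs_within_Seq, rule runs_within_NAssign, rule runs_within_for_loop)
    fix i t assume I: "I i t"
    then show "nats t ''b'' [] = i \<and> nval width t = 2 * d"
      using d by (auto simp: I_def agreeD)
    show "runs_within (NAssign ''p'' [NAdd var_b (NConst 1)] (NMul (NConst 2) (pow2 var_b))) t 0
      (\<lambda>t'. nats t' ''b'' [] = i \<and> I (Suc i) (set_nat ''b'' [] (Suc i) t'))"
      by (rule runs_within_NAssign) (use I in \<open>auto simp: I_def agree_def le_Suc_eq\<close>)
  qed (auto simp: I_def agree_def)
  then show ?thesis by (rule runs_within_weaken) (auto simp: I_def)
qed

text \<open>Entry 0 is computed from itself, as 0 div 2 = 0; hence the hypothesis on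
  \<open>pc\<close> at 0, supplied by the zero-initialised input store.\<close>

lemma runs_within_popcount_prog:
  assumes d: "nats s ''d'' [] = d" and p: "\<forall>b\<le>2 * d. nats s ''p'' [b] = 2 ^ b"
    and pc: "nats s ''pc'' [0] = 0"
  shows "runs_within popcount_prog s 0 (\<lambda>t. agree {''w'', ''pc''} s t \<and> reals t = reals s \<and>
    (\<forall>w<2 ^ (2 * d). nats t ''pc'' [w] = popcount w))"
proof -
  define I where "I i t \<longleftrightarrow> nats t ''w'' [] = i \<and> agree {''w'', ''pc''} s t \<and> reals t = reals s \<and>
    nats t ''pc'' [0] = 0 \<and> (\<forall>w<i. nats t ''pc'' [w] = popcount w)" for i t
  have "runs_within popcount_prog s (\<Sum>i<2 ^ (2 * d) :: nat. 0) (I (2 ^ (2 * d)))"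
    unfolding popcount_prog_def
  proof (rule runs_within_for_loop)
    fix i t assume I: "I i t"
    have "nats t ''d'' = nats s ''d''" "nats t ''p'' = nats s ''p''"
      using I by (auto simp: I_def agreeD)
    then show "nats t ''w'' [] = i \<and> nval (pow2 width) t = 2 ^ (2 * d)"
      using I d p by (simp add: I_def mult_2)
    have "nats t ''pc'' [i div 2] = popcount (i div 2)"
      using I by (cases "i = 0") (auto simp: I_def)
    then have "nats t ''pc'' [i div 2] + i mod 2 = popcount i"
      using popcount_rec[of i] by simp
    then show "runs_within (NAssign ''pc'' [var_w]
     (NAdd (NGet ''pc'' [NDiv var_w (NConst 2)]) (NMod var_w (NConst 2)))) t 0
      (\<lambda>t'. nats t' ''w'' [] = i \<and> I (Suc i) (set_nat ''w'' [] (Suc i) t'))"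
      by (intro runs_within_NAssign) (use I in \<open>auto simp: I_def agree_def less_Suc_eq\<close>)
  qed (use pc in \<open>auto simp: I_def agree_def\<close>)
  then show ?thesis by (rule runs_within_weaken) (auto simp: I_def)
qed


section \<open>The program for a skew circuit\<close>

text \<open>Presents every gate that is not an addition as e * u with e an input gate; codes below 2
  are exactly the inputs. For a product, skewness guarantees that the second operand is an input
  whenever the first is not. For an input gate, e is the gate itself.\<close>

definition select_prog :: com where
  "select_prog = If (Less (NGet ''code'' [var_g]) (NConst 2))
     (Seq (NAssign ''e'' [] var_g) (NAssign ''u'' [] (NGet ''gates'' [])))
     (If (Less (NGet ''code'' [NGet ''arg1'' [var_g]]) (NConst 2))
        (Seq (NAssign ''e'' [] (NGet ''arg1'' [var_g])) (NAssign ''u'' [] (NGet ''arg2'' [var_g])))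
        (Seq (NAssign ''e'' [] (NGet ''arg2'' [var_g])) (NAssign ''u'' [] (NGet ''arg1'' [var_g]))))"

definition gate_prog :: com where
  "gate_prog = If (Equal (NGet ''code'' [var_g]) (NConst 2)) plus_prog
     (Seq select_prog
       (If (Equal (NGet ''code'' [var_e]) (NConst 0)) derivative_prog scale_prog))"

text \<open>The row past the last gate is that of the constant 1: it is 1 at the empty mask and
  keeps its initial 0 elsewhere. The answer is read at mask 2^d - 1, the first d columns of the d by
  d matrix.\<close>

definition apolar_prog :: com where
  "apolar_prog = Seq pow_prog (Seq popcount_prog
     (Seq (RAssign ''y'' [NGet ''gates'' [], NConst 0] (RConst 1))
     (Seq (for_loop ''g'' (NGet ''gates'' []) gate_prog)
       (RAssign ''result'' [] (RGet ''y'' [NGet ''output'' [], NSub (pow2 var_d) (NConst 1)])))))"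

lemma gate_polys_snoc: "gate_polys (gs @ [g]) = gate_polys gs @ [gate_poly (gate_polys gs) g]"
  by (simp add: gate_polys_def)

lemma length_gate_polys [simp]: "length (gate_polys gs) = length gs"
  by (induction gs rule: rev_induct) (simp_all add: gate_polys_snoc, simp add: gate_polys_def)

lemma gate_polys_nth:
  "k < length gs \<Longrightarrow> gate_polys gs ! k = gate_poly (take k (gate_polys gs)) (gs ! k)"
  by (induction gs rule: rev_induct) (auto simp: gate_polys_snoc nth_append less_Suc_eq)

lemma popcount_eq_0_iff: "popcount w = 0 \<longleftrightarrow> w = 0"
proof (induction w rule: less_induct)
  case (less w)
  show ?case
  proof (cases "w = 0")
    case False
    then have "popcount (w div 2) = 0 \<longleftrightarrow> w div 2 = 0" by (intro less) simp
    then show ?thesis using False popcount_rec[of w] by (auto; presburger)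
  qed simp
qed

lemma pairing_one: "pairing 1 f = lk f 0"
proof -
  have "pairing 1 f = (\<Sum>m\<in>Poly_Mapping.keys f. if m = 0 then lk f 0 else 0)"
    unfolding pairing_def by (rule sum.cong) (auto simp: lookup_one when_def)
  then show ?thesis by (auto simp: in_keys_iff)
qed

locale hankel_instance =
  fixes n d :: nat and C :: circuit and X :: "rpoly mat"
  assumes wf: "wf_circuit n C" and skew: "skew C"
    and X: "X \<in> carrier_mat d d" and hankel: "hankel X"
    and linear: "\<And>i j. i < d \<Longrightarrow> j < d \<Longrightarrow> X $$ (i, j) \<in> forms n 1"
begin

text \<open>Antidiagonals are read off the first column and the last row of \<open>X\<close>.\<close>

definition entry :: "nat \<Rightarrow> rpoly" where
  "entry m = (if m < 2 * d - 1 then X $$ (m - (m - (d - 1)), m - (d - 1)) else 0)"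

definition coef :: "nat \<Rightarrow> nat \<Rightarrow> real" where
  "coef v m = coeff_array n X [m - (m - (d - 1)), m - (d - 1), v]"

abbreviation minor :: "nat \<Rightarrow> rpoly" where
  "minor w \<equiv> hankel_minor entry (columns (2 * d) w)"

text \<open>The index past the last gate stands for the constant \<open>1\<close>, so that an input gate is the product
  of itself with that gate.\<close>

definition gate_value :: "nat \<Rightarrow> rpoly" where
  "gate_value k = (if k = num_gates C then 1 else gate_polys (gates C) ! k)"

lemma homogeneous_entry: "homogeneous 1 (entry m)"
proof (cases "m < 2 * d - 1")
  case True
  then have "X $$ (m - (m - (d - 1)), m - (d - 1)) \<in> forms n 1" by (intro linear) auto
  then show ?thesis using True by (simp add: entry_def forms_homogeneous)
qed (simp add: entry_def homogeneous_def)

text \<open>Past the last antidiagonal the padding of \<open>entry\<close> and the out-of-range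
  default of \<open>coeff_array\<close> are both zero, so the identity holds for every m.\<close>

lemma partial_entry:
  assumes "v < n"
  shows "partial v (entry m) = const (coef v m)"
proof (cases "m < 2 * d - 1")
  case True
  then have "m - (m - (d - 1)) < d" "m - (d - 1) < d" by auto
  then show ?thesis
    using assms X True partial_linear_form[OF homogeneous_entry, of v m]
    by (simp add: coef_def coeff_array_def entry_def)
next
  case False
  then have "\<not> (m - (m - (d - 1)) < d \<and> m - (d - 1) < d)" by auto
  then show ?thesis
    using X False by (auto simp: coef_def coeff_array_def entry_def const_def)
qed

text \<open>A nonempty minor is a form of positive degree and has no constant term; the empty
  determinant is 1.\<close>

lemma pairing_one_minor:
  assumes "admissible (2 * d) w"
  shows "pairing 1 (minor w) = (if w = 0 then 1 else 0)"
proof (cases "w = 0")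
  case True
  then show ?thesis
    by (simp add: columns_def hankel_minor_def det_rows_def pairing_one)
next
  case False
  let ?cs = "columns (2 * d) w"
  have "0 < length ?cs"
    using False length_columns[OF admissible_less[OF assms]] popcount_eq_0_iff[of w] by simp
  moreover have "homogeneous (length ?cs) (minor w)"
    unfolding hankel_minor_def det_rows_def length_map
    by (rule homogeneous_det) (auto simp: homogeneous_entry[simplified])
  ultimately have "0 \<notin> Poly_Mapping.keys (minor w)"
    by (auto simp: homogeneous_def mdegree_def)
  with False show ?thesis by (simp add: pairing_one in_keys_iff)
qed

lemma columns_full: "columns (2 * d) (2 ^ d - 1) = [0..<d]"
proof -
  have bit: "bit (2 ^ d - 1 :: nat) b \<longleftrightarrow> b < d" for b
    using bit_mask_iff[where ?'a = nat, of d b] by (simp add: mask_eq_exp_minus_1)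
  have "[0..<2 * d] = [0..<d] @ [d..<2 * d]"
    using upt_add_eq_append[of 0 d d] by (simp add: mult_2)
  moreover have "filter (bit (2 ^ d - 1 :: nat)) [0..<d] = [0..<d]"
    by (rule filter_True) (auto simp: bit simp del: One_nat_def)
  moreover have "filter (bit (2 ^ d - 1 :: nat)) [d..<2 * d] = []"
    by (rule filter_False) (auto simp: bit simp del: One_nat_def)
  ultimately show ?thesis by (simp add: columns_def)
qed

lemma admissible_full: "admissible (2 * d) (2 ^ d - 1)"
proof -
  have "(2::nat) ^ d \<le> 2 ^ (2 * d)" by (rule power_increasing) auto
  moreover have "0 < (2::nat) ^ d" by simp
  ultimately have "(2::nat) ^ d - 1 < 2 ^ (2 * d)" by linarith
  then have "popcount (2 ^ d - 1) = d" using length_columns columns_full by fastforce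
  then show ?thesis by (simp add: admissible_def mult_2)
qed

text \<open>The Hankel property enters here: each X (i, j) equals the representative of its
  antidiagonal from which \<open>entry\<close> is read.\<close>

lemma det_eq_minor: "det X = minor (2 ^ d - 1)"
proof -
  have "mat d d (\<lambda>(q, p). (map (\<lambda>c p. entry (c + p)) [0..<d] ! q) p) = X"
  proof (rule eq_matI)
    fix i j assume "i < dim_row X" "j < dim_col X"
    then have ij: "i < d" "j < d" using X by auto
    have "i + j - (i + j - (d - 1)) < d" "i + j - (d - 1) < d" using ij by linarith+
    then have "entry (i + j) = X $$ (i, j)"
      using ij X hankel[unfolded hankel_def, rule_format,
          of "i + j - (i + j - (d - 1))" "i + j - (d - 1)" i j]
      by (auto simp: entry_def)
    with ij show "mat d d (\<lambda>(q, p). (map (\<lambda>c p. entry (c + p)) [0..<d] ! q) p) $$ (i, j) = X $$ (i, j)"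
      by simp
  qed (use X in auto)
  then show ?thesis
    by (simp only: columns_full hankel_minor_def det_rows_def length_map length_upt diff_zero)
qed

lemma gate_value_cases:
  assumes "k < num_gates C"
  shows "gate_value k = (case gates C ! k of Var v \<Rightarrow> var v | Scalar c \<Rightarrow> const c
      | Plus i j \<Rightarrow> gate_value i + gate_value j | Times i j \<Rightarrow> gate_value i * gate_value j)"
  and "wf_gate n k (gates C ! k)"
proof -
  show *: "wf_gate n k (gates C ! k)" using wf assms by (simp add: wf_circuit_def)
  show "gate_value k = (case gates C ! k of Var v \<Rightarrow> var v | Scalar c \<Rightarrow> const c
      | Plus i j \<Rightarrow> gate_value i + gate_value j | Times i j \<Rightarrow> gate_value i * gate_value j)"
    using * assms gate_polys_nth[of k "gates C"]
    by (cases "gates C ! k") (auto simp: gate_value_def num_gates_def)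
qed

definition input_kept :: "store \<Rightarrow> bool" where
  "input_kept s \<longleftrightarrow>
     (\<forall>a \<in> {''gates'', ''output'', ''code'', ''arg1'', ''arg2''}. nats s a = nats (input_store n d C X) a) \<and>
     (\<forall>a \<in> {''scalar'', ''X''}. reals s a = reals (input_store n d C X) a)"

lemma input_kept_agree:
  assumes "input_kept s" "agree {''g'', ''e'', ''u'', ''w'', ''b'', ''r'', ''i'', ''p'', ''pc''} s t"
    "reals t ''scalar'' = reals s ''scalar''" "reals t ''X'' = reals s ''X''"
  shows "input_kept t"
  using assms by (auto simp: input_kept_def agreeD)

lemma input_keptD:
  assumes "input_kept s"
  shows "nats s ''gates'' [] = num_gates C" "nats s ''output'' [] = out_gate C"
    "k < num_gates C \<Longrightarrow> nats s ''code'' [k] = gate_code (gates C ! k)"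
    "k < num_gates C \<Longrightarrow> nats s ''arg1'' [k] = gate_arg1 (gates C ! k)"
    "k < num_gates C \<Longrightarrow> nats s ''arg2'' [k] = gate_arg2 (gates C ! k)"
    "k < num_gates C \<Longrightarrow> reals s ''scalar'' [k] = gate_scalar (gates C ! k)"
    "reals s ''X'' = coeff_array n X"
  using assms by (auto simp: input_kept_def input_store_def scalar_array_def gate_array_def)

lemma runs_within_select_prog:
  assumes s: "input_kept s" and g: "nats s ''g'' [] = g" "g < num_gates C"
    and not_plus: "gate_code (gates C ! g) \<noteq> 2"
  shows "runs_within select_prog s 0 (\<lambda>t. agree {''e'', ''u''} s t \<and> reals t = reals s \<and>
    (\<exists>e u. nats t ''e'' [] = e \<and> nats t ''u'' [] = u \<and> e < num_gates C \<and> is_input (gates C ! e) \<and>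
      (u < g \<or> u = num_gates C) \<and> gate_value g = gate_value e * gate_value u))"
    (is "runs_within _ _ _ ?Q")
proof -
  note inp = input_keptD[OF s]
  have assign: "runs_within (Seq (NAssign ''e'' [] x) (NAssign ''u'' [] z)) s 0 ?Q"
    if "nval x s = e" "\<And>k. nval z (set_nat ''e'' [] k s) = u" "e < num_gates C" "is_input (gates C ! e)"
      "u < g \<or> u = num_gates C" "gate_value g = gate_value e * gate_value u" for x z e u
  proof -
    have "runs_within (Seq (NAssign ''e'' [] x) (NAssign ''u'' [] z)) s (0 + 0) ?Q"
      by (rule runs_within_Seq, rule runs_within_NAssign, rule runs_within_NAssign)
         (use that in \<open>auto simp: agree_def\<close>)
    then show ?thesis by simp
  qed
  have code: "gate_code h < 2 \<longleftrightarrow> is_input h" for h by (cases h) auto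
  have one: "gate_value (num_gates C) = 1" by (simp add: gate_value_def)
  show ?thesis unfolding select_prog_def
  proof (rule runs_within_If)
    assume "bval (Less (NGet ''code'' [var_g]) (NConst 2)) s"
    then have "is_input (gates C ! g)" using g inp by (simp add: code)
    then show "runs_within (Seq (NAssign ''e'' [] var_g) (NAssign ''u'' [] (NGet ''gates'' []))) s 0 ?Q"
      by (intro assign[where e = g and u = "num_gates C"]) (use g inp one in auto)
  next
    assume "\<not> bval (Less (NGet ''code'' [var_g]) (NConst 2)) s"
    then have "\<not> gate_code (gates C ! g) < 2" using g inp by simp
    then obtain i j where ij: "gates C ! g = Times i j" using not_plus by (cases "gates C ! g") auto
    then have lt: "i < g" "j < g" and val: "gate_value g = gate_value i * gate_value j"
      using gate_value_cases[OF g(2)] by auto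
    have args: "nats s ''arg1'' [g] = i" "nats s ''arg2'' [g] = j" using g inp ij by auto
    show "runs_within (If (Less (NGet ''code'' [NGet ''arg1'' [var_g]]) (NConst 2))
        (Seq (NAssign ''e'' [] (NGet ''arg1'' [var_g])) (NAssign ''u'' [] (NGet ''arg2'' [var_g])))
        (Seq (NAssign ''e'' [] (NGet ''arg2'' [var_g])) (NAssign ''u'' [] (NGet ''arg1'' [var_g])))) s 0 ?Q"
    proof (rule runs_within_If)
      assume "bval (Less (NGet ''code'' [NGet ''arg1'' [var_g]]) (NConst 2)) s"
      then have "is_input (gates C ! i)" using g args lt inp(3)[of i] by (simp add: code)
      then show "runs_within (Seq (NAssign ''e'' [] (NGet ''arg1'' [var_g])) (NAssign ''u'' [] (NGet ''arg2'' [var_g]))) s 0 ?Q"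
        by (intro assign[where e = i and u = j]) (use g args lt val in auto)
    next
      assume "\<not> bval (Less (NGet ''code'' [NGet ''arg1'' [var_g]]) (NConst 2)) s"
      then have "\<not> is_input (gates C ! i)" using g args lt inp(3)[of i] by (simp add: code)
      then have "is_input (gates C ! j)" using skew g(2) ij by (auto simp: skew_def)
      then show "runs_within (Seq (NAssign ''e'' [] (NGet ''arg2'' [var_g])) (NAssign ''u'' [] (NGet ''arg1'' [var_g]))) s 0 ?Q"
        by (intro assign[where e = j and u = i]) (use g args lt val in \<open>auto simp: mult.commute\<close>)
    qed
  qed
qed

definition rows_ready :: "nat \<Rightarrow> store \<Rightarrow> bool" where
  "rows_ready g s \<longleftrightarrow> (\<forall>k w. (k < g \<or> k = num_gates C) \<longrightarrow> admissible (2 * d) w \<longrightarrow>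
     reals s ''y'' [k, w] = pairing (gate_value k) (minor w))"

text \<open>Per admissible mask: 2 d (d + 1) additions for the shift table, 4 d^2 operations for the
  derivative sums, and the 1 that covers an addition or scaling gate even when d = 0.\<close>

definition gate_cost :: nat where
  "gate_cost = num_admissible d * (6 * d ^ 2 + 2 * d + 1)"

lemma rows_ready_Suc:
  assumes s: "rows_ready g s" and g: "g < num_gates C"
    and t: "reals t ''y'' = overwrite ''y'' (mask_row d g) F (reals s) ''y''"
    and F: "\<And>w. admissible (2 * d) w \<Longrightarrow> F [g, w] = pairing (gate_value g) (minor w)"
  shows "rows_ready (Suc g) t"
  using s g F by (auto simp: rows_ready_def t overwrite_same mask_row_def less_Suc_eq)

text \<open>Linearity of the pairing in the gate settles additions and scalars, the adjunction
  settles variables. The rows read are complete because operands precede g or are the row of the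
  constant 1.\<close>

lemma runs_within_gate_prog:
  assumes s: "masks_ready d s" "input_kept s" "rows_ready g s" and g: "nats s ''g'' [] = g" "g < num_gates C"
  shows "runs_within gate_prog s gate_cost (\<lambda>t. agree {''e'', ''u'', ''w'', ''b'', ''r'', ''i''} s t \<and>
    (\<forall>a. a \<noteq> ''y'' \<longrightarrow> a \<noteq> ''Y'' \<longrightarrow> reals t a = reals s a) \<and> rows_ready (Suc g) t)"
    (is "runs_within _ _ _ ?Q")
proof -
  note inp = input_keptD[OF s(2)]
  have cost: "num_admissible d \<le> gate_cost" by (simp add: gate_cost_def)
  have cost': "num_admissible d * (2 * d * Suc d) + num_admissible d * (2 * d * (d * 2)) \<le> gate_cost"
    unfolding gate_cost_def distrib_left[symmetric]
    by (rule mult_left_mono) (auto simp: power2_eq_square algebra_simps)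
  have row: "reals s ''y'' [k, w] = pairing (gate_value k) (minor w)"
    if "k < g \<or> k = num_gates C" "admissible (2 * d) w" for k w
    using s(3) that unfolding rows_ready_def by blast
  show ?thesis unfolding gate_prog_def
  proof (rule runs_within_If)
    assume "bval (Equal (NGet ''code'' [var_g]) (NConst 2)) s"
    then obtain i j where ij: "gates C ! g = Plus i j"
      using g inp by (cases "gates C ! g") auto
    then have lt: "i < g" "j < g" and val: "gate_value g = gate_value i + gate_value j"
      using gate_value_cases[OF g(2)] by auto
    have args: "nats s ''arg1'' [g] = i" "nats s ''arg2'' [g] = j" using g inp ij by auto
    show "runs_within plus_prog s gate_cost ?Q"
    proof (rule runs_within_weaken[OF runs_within_plus_prog[OF s(1) g(1) args] cost])
      fix t assume t: "agree {''w''} s t \<and> reals t = overwrite ''y'' (mask_row d g)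
        (\<lambda>ks. reals s ''y'' [i, ks ! 1] + reals s ''y'' [j, ks ! 1]) (reals s)"
      then have "rows_ready (Suc g) t"
        by (intro rows_ready_Suc[OF s(3) g(2), of t]) (auto simp: row lt val pairing_add_left)
      with t show "?Q t" by (auto simp: agree_def overwrite_other)
    qed (use lt in auto)
  next
    assume "\<not> bval (Equal (NGet ''code'' [var_g]) (NConst 2)) s"
    then have code: "gate_code (gates C ! g) \<noteq> 2" using g inp by simp
    have "runs_within (Seq select_prog (If (Equal (NGet ''code'' [var_e]) (NConst 0)) derivative_prog scale_prog))
      s (0 + gate_cost) ?Q"
    proof (rule runs_within_Seq, rule runs_within_weaken[OF runs_within_select_prog[OF s(2) g code] order_refl], elim conjE exE)
      fix t e u assume t: "agree {''e'', ''u''} s t" "reals t = reals s"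
        and eu: "nats t ''e'' [] = e" "nats t ''u'' [] = u" "e < num_gates C" "is_input (gates C ! e)"
          "u < g \<or> u = num_gates C" "gate_value g = gate_value e * gate_value u"
      have ready: "masks_ready d t" by (rule masks_ready_agree[OF s(1) t(1)]) simp
      have kept: "input_kept t"
        by (rule input_kept_agree[OF s(2)]) (use t in \<open>auto simp: agree_def\<close>)
      note inp' = input_keptD[OF kept]
      have tg: "nats t ''g'' [] = g" using t g by (simp add: agreeD)
      have ug: "u \<noteq> g" using eu g by auto
      show "runs_within (If (Equal (NGet ''code'' [var_e]) (NConst 0)) derivative_prog scale_prog) t gate_cost ?Q"
      proof (rule runs_within_If)
        assume "bval (Equal (NGet ''code'' [var_e]) (NConst 0)) t"
        then obtain v where v: "gates C ! e = Var v"
          using eu inp' by (cases "gates C ! e") auto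
        then have vn: "v < n" and ev: "gate_value e = var v"
          using gate_value_cases[OF eu(3)] by auto
        have X': "reals t ''X'' [m - (m - (d - 1)), m - (d - 1), nats t ''arg1'' [e]] = coef v m" for m
          using inp'(4)[OF eu(3)] inp'(7) v by (simp add: coef_def)
        show "runs_within derivative_prog t gate_cost ?Q"
        proof (rule runs_within_weaken[OF runs_within_derivative_prog[OF ready tg eu(1,2) X'] cost'], elim conjE)
          fix t' assume t': "agree {''w'', ''r'', ''b'', ''i''} t t'"
            "\<forall>a. a \<noteq> ''y'' \<longrightarrow> a \<noteq> ''Y'' \<longrightarrow> reals t' a = reals t a"
            "reals t' ''y'' = overwrite ''y'' (mask_row d g) (\<lambda>ks. derivative_step (2 * d) (coef v)
              (\<lambda>w. reals t ''y'' [u, w]) (ks ! 1)) (reals t) ''y''"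
          have "rows_ready (Suc g) t'"
          proof (rule rows_ready_Suc[OF s(3) g(2) t'(3)[unfolded t(2)]])
            fix w assume w: "admissible (2 * d) w"
            have "derivative_step (2 * d) (coef v) (\<lambda>w. reals s ''y'' [u, w]) w =
                pairing (var v * gate_value u) (minor w)"
              by (rule pairing_var_mult_hankel_minor[symmetric, OF partial_entry[OF vn] _ w])
                 (use row eu in auto)
            then show "derivative_step (2 * d) (coef v) (\<lambda>w. reals s ''y'' [u, w]) ([g, w] ! 1) =
                pairing (gate_value g) (minor w)"
              by (simp add: eu(6) ev)
          qed
          moreover have "agree {''e'', ''u'', ''w'', ''b'', ''r'', ''i''} s t'"
            by (rule agree_trans[OF t(1) t'(1)]) auto
          ultimately show "?Q t'" using t'(2) t(2) by simp
        qed
      next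
        assume "\<not> bval (Equal (NGet ''code'' [var_e]) (NConst 0)) t"
        then obtain c where c: "gates C ! e = Scalar c"
          using eu inp' by (cases "gates C ! e") auto
        then have ec: "gate_value e = const c"
          using gate_value_cases[OF eu(3)] by auto
        have sc: "reals t ''scalar'' [e] = c" using inp'(6)[OF eu(3)] c by simp
        show "runs_within scale_prog t gate_cost ?Q"
        proof (rule runs_within_weaken[OF runs_within_scale_prog[OF ready tg eu(1,2) ug] cost], elim conjE)
          fix t' assume t': "agree {''w''} t t'" "reals t' = overwrite ''y'' (mask_row d g)
            (\<lambda>ks. reals t ''scalar'' [e] * reals t ''y'' [u, ks ! 1]) (reals t)"
          have "rows_ready (Suc g) t'"
            by (rule rows_ready_Suc[OF s(3) g(2) arg_cong[OF t'(2)[unfolded t(2)], of "\<lambda>R. R ''y''"]])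
               (use row eu sc t(2) in \<open>auto simp: ec pairing_const_mult_left\<close>)
          moreover have "agree {''e'', ''u'', ''w'', ''b'', ''r'', ''i''} s t'"
            by (rule agree_trans[OF t(1) t'(1)]) auto
          ultimately show "?Q t'" using t'(2) t(2) by (simp add: overwrite_other)
        qed
      qed
    qed
    then show "runs_within (Seq select_prog (If (Equal (NGet ''code'' [var_e]) (NConst 0)) derivative_prog scale_prog))
      s gate_cost ?Q" by simp
  qed
qed

lemma runs_within_gate_loop:
  assumes s: "masks_ready d s" "input_kept s" "rows_ready 0 s"
  shows "runs_within (for_loop ''g'' (NGet ''gates'' []) gate_prog) s (num_gates C * gate_cost)
    (\<lambda>t. masks_ready d t \<and> input_kept t \<and> rows_ready (num_gates C) t)"
proof -
  define I where "I i t \<longleftrightarrow> nats t ''g'' [] = i \<and> masks_ready d t \<and> input_kept t \<and> rows_ready i t" for i t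
  have set_g: "masks_ready d (set_nat ''g'' [] i t) = masks_ready d t"
    "input_kept (set_nat ''g'' [] i t) = input_kept t" "rows_ready k (set_nat ''g'' [] i t) = rows_ready k t"
    for i k t by (simp_all add: masks_ready_def input_kept_def rows_ready_def)
  have "runs_within (for_loop ''g'' (NGet ''gates'' []) gate_prog) s (\<Sum>i<num_gates C. gate_cost) (I (num_gates C))"
  proof (rule runs_within_for_loop)
    show "I 0 (set_nat ''g'' [] 0 s)" using s by (simp add: I_def set_g del: nats_set_nat) simp
  next
    fix i t assume "I i t"
    then show "nats t ''g'' [] = i \<and> nval (NGet ''gates'' []) t = num_gates C"
      by (simp add: I_def input_keptD)
  next
    fix i t assume i: "i < num_gates C" and I: "I i t"
    then have t: "masks_ready d t" "input_kept t" "rows_ready i t" "nats t ''g'' [] = i"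
      by (auto simp: I_def)
    show "runs_within gate_prog t gate_cost (\<lambda>t'. nats t' ''g'' [] = i \<and> I (Suc i) (set_nat ''g'' [] (Suc i) t'))"
    proof (rule runs_within_weaken[OF runs_within_gate_prog[OF t i] order_refl], elim conjE)
      fix t' assume t': "agree {''e'', ''u'', ''w'', ''b'', ''r'', ''i''} t t'"
        "\<forall>a. a \<noteq> ''y'' \<longrightarrow> a \<noteq> ''Y'' \<longrightarrow> reals t' a = reals t a" "rows_ready (Suc i) t'"
      have "masks_ready d t'" by (rule masks_ready_agree[OF t(1) t'(1)]) simp
      moreover have "input_kept t'"
        by (rule input_kept_agree[OF t(2)]) (use t' in \<open>auto simp: agree_def\<close>)
      moreover have "nats t' ''g'' [] = i" using t' t(4) by (simp add: agreeD)
      ultimately show "nats t' ''g'' [] = i \<and> I (Suc i) (set_nat ''g'' [] (Suc i) t')"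
        using t'(3) by (simp add: I_def set_g del: nats_set_nat) simp
    qed
  qed
  then show ?thesis by (rule runs_within_weaken) (auto simp: I_def)
qed

lemma runs_within_apolar_prog:
  "runs_within apolar_prog (input_store n d C X) (num_gates C * gate_cost)
    (\<lambda>t. result t = pairing (gate_value (out_gate C)) (det X))"
    (is "runs_within _ ?s0 _ ?Q")
proof -
  have d0: "nats ?s0 ''d'' [] = d" by (simp add: input_store_def scalar_array_def)
  have "runs_within apolar_prog ?s0 (0 + (0 + (0 + (num_gates C * gate_cost + 0)))) ?Q"
    unfolding apolar_prog_def
  proof (rule runs_within_Seq, rule runs_within_weaken[OF runs_within_pow_prog[OF d0] order_refl], elim conjE)
    fix t1 assume t1: "agree {''b'', ''p''} ?s0 t1" "reals t1 = reals ?s0"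
      "\<forall>b\<le>2 * d. nats t1 ''p'' [b] = 2 ^ b"
    have d1: "nats t1 ''d'' [] = d" using t1 d0 by (simp add: agreeD)
    have pc1: "nats t1 ''pc'' [0] = 0" using t1 by (simp add: agreeD input_store_def)
    show "runs_within (Seq popcount_prog
     (Seq (RAssign ''y'' [NGet ''gates'' [], NConst 0] (RConst 1))
     (Seq (for_loop ''g'' (NGet ''gates'' []) gate_prog)
       (RAssign ''result'' [] (RGet ''y'' [NGet ''output'' [], NSub (pow2 var_d) (NConst 1)])))))
      t1 (0 + (0 + (num_gates C * gate_cost + 0))) ?Q"
    proof (rule runs_within_Seq, rule runs_within_weaken[OF runs_within_popcount_prog[OF d1 t1(3) pc1] order_refl], elim conjE)
      fix t2 assume t2: "agree {''w'', ''pc''} t1 t2" "reals t2 = reals t1"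
        "\<forall>w<2 ^ (2 * d). nats t2 ''pc'' [w] = popcount w"
      have "nats t2 ''p'' = nats t1 ''p''" using t2(1) by (simp add: agreeD)
      then have ready2: "masks_ready d t2"
        using t1 t2 d1 by (simp add: masks_ready_def agreeD)
      have kept2: "input_kept t2"
        using t1(1,2) t2(1,2) by (auto simp: input_kept_def agreeD)
      let ?t3 = "set_real ''y'' [num_gates C, 0] 1 t2"
      have kept3: "input_kept ?t3" using kept2 by (simp add: input_kept_def)
      have ready3: "masks_ready d ?t3" using ready2 by (simp add: masks_ready_def)
      have "reals t2 ''y'' = (\<lambda>ks. 0)" using t1 t2 by (simp add: input_store_def)
      then have rows3: "rows_ready 0 ?t3"
        by (simp add: rows_ready_def gate_value_def pairing_one_minor)
      show "runs_within (Seq (RAssign ''y'' [NGet ''gates'' [], NConst 0] (RConst 1))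
       (Seq (for_loop ''g'' (NGet ''gates'' []) gate_prog)
         (RAssign ''result'' [] (RGet ''y'' [NGet ''output'' [], NSub (pow2 var_d) (NConst 1)]))))
        t2 (0 + (num_gates C * gate_cost + 0)) ?Q"
      proof (rule runs_within_Seq, rule runs_within_RAssign)
        have "runs_within (Seq (for_loop ''g'' (NGet ''gates'' []) gate_prog)
         (RAssign ''result'' [] (RGet ''y'' [NGet ''output'' [], NSub (pow2 var_d) (NConst 1)])))
          ?t3 (num_gates C * gate_cost + 0) ?Q"
        proof (rule runs_within_Seq, rule runs_within_weaken[OF runs_within_gate_loop[OF ready3 kept3 rows3] order_refl], elim conjE)
          fix t assume t: "masks_ready d t" "input_kept t" "rows_ready (num_gates C) t"
          have "nats t ''p'' [d] = 2 ^ d" "nats t ''d'' [] = d"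
            using t(1) by (simp_all add: masks_ready_def)
          moreover have "reals t ''y'' [out_gate C, 2 ^ d - Suc 0] = pairing (gate_value (out_gate C)) (det X)"
            using t(3) wf admissible_full by (simp add: rows_ready_def wf_circuit_def det_eq_minor)
          ultimately show "runs_within (RAssign ''result'' []
              (RGet ''y'' [NGet ''output'' [], NSub (pow2 var_d) (NConst 1)])) t 0 ?Q"
            by (intro runs_within_RAssign) (simp_all add: result_def input_keptD[OF t(2)])
        qed
        then show "runs_within (Seq (for_loop ''g'' (NGet ''gates'' []) gate_prog)
         (RAssign ''result'' [] (RGet ''y'' [NGet ''output'' [], NSub (pow2 var_d) (NConst 1)])))
          (set_real ''y'' (map (\<lambda>e. nval e t2) [NGet ''gates'' [], NConst 0]) (rval (RConst 1) t2) t2)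
          (num_gates C * gate_cost + 0) ?Q"
          using input_keptD(1)[OF kept2] by simp
      qed simp
    qed
  qed
  then show ?thesis by simp
qed

text \<open>Coefficients are listed from the constant term up, so the polynomial is the factor 1 + 2
  d + 6 d^2 of \<open>gate_cost\<close>.\<close>

lemma gate_cost_le: "real gate_cost \<le> golden_ratio ^ (2 * d) * poly [:1, 2, 6:] (real d)"
proof -
  have "real gate_cost = real (num_admissible d) * poly [:1, 2, 6:] (real d)"
    by (simp add: gate_cost_def power2_eq_square algebra_simps)
  also have "\<dots> \<le> golden_ratio ^ (2 * d) * poly [:1, 2, 6:] (real d)"
    by (intro mult_right_mono card_admissible) simp
  finally show ?thesis .
qed

end

theorem theorem2:
  shows "\<exists>(prog :: com) (p :: real poly).
    \<forall>(n :: nat) (d :: nat) (g :: rpoly) (C :: circuit) (X :: rpoly mat).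
      g \<in> forms n d \<longrightarrow>
      wf_circuit n C \<longrightarrow> skew C \<longrightarrow> computes C g \<longrightarrow>
      X \<in> carrier_mat d d \<longrightarrow> hankel X \<longrightarrow>
      (\<forall>i<d. \<forall>j<d. X $$ (i, j) \<in> forms n 1) \<longrightarrow>
      (\<exists>N t. run prog (input_store n d C X) N t \<and>
         const (result t) = apolar (det X) g \<and>
         real N \<le> golden_ratio ^ (2 * d) * poly p (real d) * real (num_gates C))"
proof (intro exI[of _ apolar_prog] exI[of _ "[:1, 2, 6:]"] allI impI)
  fix n d g C X
  assume g: "g \<in> forms n d" and wf: "wf_circuit n C" and skew: "skew C" and computes: "computes C g"
    and mat: "X \<in> carrier_mat d d" "hankel X" "\<forall>i<d. \<forall>j<d. X $$ (i, j) \<in> forms n 1"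
  interpret hankel_instance n d C X
    using wf skew mat by unfold_locales auto
  have "gate_value (out_gate C) = g"
    using computes wf by (auto simp: gate_value_def computes_def wf_circuit_def)
  then obtain N t where t: "run apolar_prog (input_store n d C X) N t" "N \<le> num_gates C * gate_cost"
      "result t = pairing g (det X)"
    using runs_within_apolar_prog unfolding runs_within_def by auto
  \<comment> \<open>The program returns a pairing; only because \<open>det X\<close> and g are both
    forms of degree d is it the constant \<open>apolar (det X) g\<close>.\<close>
  have "homogeneous d (det X)"
    using mat by (intro homogeneous_det) (blast intro: forms_homogeneous)+
  then have "const (result t) = apolar (det X) g"
    using apolar_eq_pairing forms_homogeneous[OF g] t(3) by simp
  moreover have "real N \<le> golden_ratio ^ (2 * d) * poly [:1, 2, 6:] (real d) * real (num_gates C)"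
  proof -
    have "real N \<le> real gate_cost * real (num_gates C)"
      using t(2) by (simp flip: of_nat_mult add: mult.commute)
    also have "\<dots> \<le> golden_ratio ^ (2 * d) * poly [:1, 2, 6:] (real d) * real (num_gates C)"
      by (intro mult_right_mono gate_cost_le) simp
    finally show ?thesis .
  qed
  ultimately show "\<exists>N t. run apolar_prog (input_store n d C X) N t \<and>
      const (result t) = apolar (det X) g \<and>
      real N \<le> golden_ratio ^ (2 * d) * poly [:1, 2, 6:] (real d) * real (num_gates C)"
    using t(1) by blast
qed

end
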